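(* Let the standing assumptions (A1)–(A4) of the context hold. Let $\{h_n\}_{n\ge 1}$ be a positive deterministic sequence with $h_n\downarrow 0$, and put $\bar h:=\sup_{n\ge1}h_n<\infty$. Suppose that: (a) $\widetilde g:\mathbb R^d\to\mathbb R_+$ is a probability density that is even symmetric ($\widetilde g(-u)=\widetilde g(u)$) and has compact support $\mathcal S:=\operatorname{supp}(\widetilde g)\subset\mathbb R^d$. (b) The set $\mathcal X^+:=\{z+tu: z\in\mathcal X,\ u\in\mathcal S,\ t\in[0,\bar h]\}$ is contained in $\mathcal O$; the regression function $c$ is $C^3$-smooth on $\mathcal O$, and its second- and third-order derivatives are uniformly bounded on $\mathcal O$. (c) The kernel $K:\mathbb R^d\to\mathbb R_+$ is even symmetric and bounded on $\mathcal S$, and there exists $\kappa>0$ such that $$\int_{\mathcal S}K(u)\,\widetilde g(u)\,\psi(u)\psi(u)^\top\,du\succeq\kappa\,\mathbb I_{d+1},\qquad \psi(u):=(1,u^\top)^\top\in\mathbb R^{d+1}.$$ For $z\in\mathcal X$ and $n\ge1$, let the design points $X_1,\dots,X_n$ be i.i.d. from the adaptive density $h_n^{-d}\,\widetilde g((\cdot-z)/h_n)$, and let $\widehat\nabla c_n(z)$ be the truncated local linear regression estimate with truncation level $\widehat\ell_c\ge\ell_c$, as defined in the context. Then there exist positive constants $C_0,C_1,c_0$, independent of $z$ and $n$, such that for all $n\ge1$ $$\sup_{z\in\mathcal X}\mathbb E\left[\left\|\widehat\nabla c_n(z)-\nabla c(z)\right\|^2\right]\le C_0\left(h_n^4+\frac{1}{n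 h_n^2}\right)+C_1\exp(-c_0 n).$$
   Context: $\|\cdot\|$ is the Euclidean norm for vectors and the induced operator norm for matrices. $\nabla c(z)\in\mathbb R^{\ell\times d}$ denotes the Jacobian of $c$ at $z$. A function $\phi$ on an open convex set is $\lambda$-weakly convex if $\phi(\cdot)+\frac{\lambda}{2}\|\cdot\|^2$ is convex there. Standing assumptions: (A1) $\mathcal X\subseteq\mathbb R^d$ is nonempty, closed, convex, and contained in an open convex set $\mathcal O\subseteq\mathbb R^d$. (A2) The cost function $\varphi:\mathcal O\times\mathbb R^\ell\to\mathbb R$ is $\lambda$-weakly convex ($\lambda\ge0$) and $\ell_\varphi$-Lipschitz continuous. (A3) For a decision $x$, the random vector $\xi$ satisfies $\xi=c(x)+\varepsilon$, where $\varepsilon\in\mathbb R^\ell$ is a random vector whose distribution does not depend on $x$, with $\mathbb E[\varepsilon]=0$ and $\mathbb E\|\varepsilon\|^2<\infty$. (A4) $c:\mathcal O\to\mathbb R^\ell$ is $\ell_c$-Lipschitz continuous and $C^1$-smooth with $L_c$-Lipschitz continuous Jacobian. Data and estimator. The design points can be written $X_i=z+h_nU_i$, with $U_1,\dots,U_n$ i.i.d. with density $\widetilde g$. The responses are $\xi_i=c(X_i)+\varepsilon_i$, where $\varepsilon_1,\dots,\varepsilon_n$ are i.i.d. copies of $\varepsilon$, independent of $(U_1,\dots,U_n)$. Let $(\bar c_n(z),G_n(z))$ be a (measurably selected) element of $$\operatorname*{argmin}_{(b,A)\in\mathbb R^\ell\times\mathbb R^{\ell\times d}}\ \sum_{i=1}^nK(U_i)\,\|\xi_i-b-h_nAU_i\|^2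 .$$ For a fixed scalar $\widehat\ell_c\ge\ell_c$, the truncated estimate is $$\widehat\nabla c_n(z):=\min\left\{1,\frac{\widehat\ell_c}{\|G_n(z)\|}\right\}G_n(z),$$ understood as $0$ when $G_n(z)=0$. *)

theory Defs
  imports "HOL-Probability.Probability"
begin

definition weakly_convex_on :: "real \<Rightarrow> 'a::real_inner set \<Rightarrow> ('a \<Rightarrow> real) \<Rightarrow> bool" where
  "weakly_convex_on lam S f \<longleftrightarrow> convex_on S (\<lambda>x. f x + lam / 2 * (norm x)\<^sup>2)"

text \<open>The class \<open>C\<^sup>k\<close> on an open set. In finite dimension, continuity of all iterated directional
  derivatives up to order \<open>k\<close> is continuity of the derivatives as multilinear maps.\<close>

fun Ck_on :: "nat \<Rightarrow> 'a::euclidean_space set \<Rightarrow> ('a \<Rightarrow> 'b::euclidean_space) \<Rightarrow> bool" where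
  "Ck_on 0 S f \<longleftrightarrow> continuous_on S f"
| "Ck_on (Suc k) S f \<longleftrightarrow>
     (\<forall>x\<in>S. f differentiable (at x)) \<and> (\<forall>v. Ck_on k S (\<lambda>x. frechet_derivative f (at x) v))"

text \<open>\<open>iter_deriv f vs x\<close> is the derivative of order \<open>length vs\<close> of \<open>f\<close> at \<open>x\<close>, evaluated at
  the vectors \<open>vs\<close>.\<close>

fun iter_deriv :: "('a::euclidean_space \<Rightarrow> 'b::euclidean_space) \<Rightarrow> 'a list \<Rightarrow> 'a \<Rightarrow> 'b" where
  "iter_deriv f [] x = f x"
| "iter_deriv f (v # vs) x = frechet_derivative (iter_deriv f vs) (at x) v"

text \<open>The operator norms of the multilinear maps \<open>D\<^sup>k f(x)\<close> are bounded uniformly over \<open>x \<in> S\<close>.\<close>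

definition deriv_bounded_on ::
    "nat \<Rightarrow> 'a::euclidean_space set \<Rightarrow> ('a \<Rightarrow> 'b::euclidean_space) \<Rightarrow> bool" where
  "deriv_bounded_on k S f \<longleftrightarrow>
     (\<exists>B. \<forall>x\<in>S. \<forall>vs. length vs = k \<longrightarrow>
        norm (iter_deriv f vs x) \<le> B * prod_list (map norm vs))"

text \<open>The library norm on \<open>real ^ 'd ^ 'l\<close> is the Frobenius norm, not the induced one.\<close>

definition op_norm :: "real ^ 'd ^ 'l \<Rightarrow> real" where
  "op_norm A = onorm (\<lambda>v. A *v v)"

definition loewner_ge :: "real ^ 'n ^ 'n \<Rightarrow> real ^ 'n ^ 'n \<Rightarrow> bool" where
  "loewner_ge A B \<longleftrightarrow> transpose (A - B) = A - B \<and> (\<forall>v. 0 \<le> v \<bullet> ((A - B) *v v))"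

definition supp :: "('a::euclidean_space \<Rightarrow> real) \<Rightarrow> 'a set" where
  "supp f = closure {u. f u \<noteq> 0}"

text \<open>\<open>\<psi>(u) = (1, u)\<close>; the index type \<open>'d option\<close> has \<open>d + 1\<close> elements, \<open>None\<close> being the index of
  the constant coordinate.\<close>

definition \<psi> :: "real ^ 'd \<Rightarrow> real ^ ('d option)" where
  "\<psi> u = (\<chi> i. case i of None \<Rightarrow> 1 | Some j \<Rightarrow> u $ j)"

definition outer :: "real ^ 'n \<Rightarrow> real ^ 'n ^ 'n" where
  "outer v = (\<chi> i j. v $ i * v $ j)"

text \<open>Independence of two random variables whose value types may differ; the library's
  \<open>indep_var\<close> requires both value types to be the same.\<close>

definition indep_rv ::
    "'w measure \<Rightarrow> 'a measure \<Rightarrow> ('w \<Rightarrow> 'a) \<Rightarrow> 'b measure \<Rightarrow> ('w \<Rightarrow> 'b) \<Rightarrow> bool" where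
  "indep_rv M S X T Y \<longleftrightarrow> X \<in> measurable M S \<and> Y \<in> measurable M T \<and>
     prob_space.indep_set M {X -` A \<inter> space M | A. A \<in> sets S} {Y -` B \<inter> space M | B. B \<in> sets T}"

definition local_linear_loss ::
    "(real ^ 'd \<Rightarrow> real) \<Rightarrow> real \<Rightarrow> nat \<Rightarrow> (nat \<Rightarrow> real ^ 'd) \<Rightarrow> (nat \<Rightarrow> real ^ 'l)
      \<Rightarrow> (real ^ 'l) \<times> (real ^ 'd ^ 'l) \<Rightarrow> real" where
  "local_linear_loss K h n u y =
     (\<lambda>(b, A). \<Sum>i=1..n. K (u i) * (norm (y i - b - h *\<^sub>R (A *v u i)))\<^sup>2)"

definition truncate :: "real \<Rightarrow> real ^ 'd ^ 'l \<Rightarrow> real ^ 'd ^ 'l" where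
  "truncate L G = (if G = 0 then 0 else min 1 (L / op_norm G) *\<^sub>R G)"

end

theory Submission
  imports Defs
begin

text \<open>
  The normal equations of the weighted least squares problem decouple over the rows of the
  regression matrix. With \<open>u\<^sub>i = (X\<^sub>i - z) / h\<close>, the \<open>k\<close>-th row of the error, rescaled to
  \<open>v = (b - c(z), h (A - \<nabla>c(z)))\<^sub>k\<close>, solves \<open>T v = s\<close>, where \<open>T\<close> is the empirical moment
  matrix of \<open>\<psi>(u\<^sub>i)\<close> and \<open>s\<close> is the empirical mean of \<open>K(u\<^sub>i) \<psi>(u\<^sub>i) (r(u\<^sub>i) + \<epsilon>\<^sub>i)\<^sub>k\<close>, with \<open>r\<close> the
  first order Taylor remainder of \<open>c\<close> at \<open>z\<close>. By Hoeffding's inequality \<open>T\<close> is within \<open>\<kappa>/2\<close> of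
  the population matrix \<open>S\<close> outside an event of exponentially small probability, on which
  truncation bounds the error. Elsewhere \<open>T\<close> is nondegenerate. By symmetry \<open>S\<close> is block diagonal,
  so up to a term of size \<open>\<parallel>T - S\<parallel> \<parallel>s\<parallel>\<close> the slope part of \<open>v\<close> is governed by the slope part of
  \<open>s\<close> alone, where the even, quadratic part of \<open>r\<close> has mean zero. This leaves a mean of order
  \<open>h\<^sup>3\<close> and fluctuations of variance \<open>1/n\<close>; dividing by \<open>h\<close> gives the rate.
\<close>

subsection \<open>Taylor remainders\<close>

lemma iter_deriv_Nil: "iter_deriv f [] = f"
  by (rule ext) simp

text \<open>The head of the list in \<open>iter_deriv\<close> is the outermost derivative, whereas
  \<open>Ck_on\<close> peels off the innermost one. Moving the last direction into the function
  reconciles the two recursions and makes induction from the end of the list possible.\<close>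

lemma iter_deriv_snoc:
  "iter_deriv f (vs @ [v]) = iter_deriv (\<lambda>x. frechet_derivative f (at x) v) vs"
proof (induction vs)
  case Nil
  show ?case by (rule ext) (simp add: iter_deriv_Nil)
next
  case (Cons w vs)
  show ?case by (rule ext) (simp add: Cons)
qed

lemma iter_deriv_differentiable:
  assumes "Ck_on k S f" "length vs < k" "x \<in> S"
  shows "iter_deriv f vs differentiable (at x)"
  using assms
proof (induction vs arbitrary: f k rule: rev_induct)
  case Nil
  then show ?case by (cases k) (auto simp: iter_deriv_Nil)
next
  case (snoc v vs)
  then obtain j where "k = Suc j" "Ck_on j S (\<lambda>x. frechet_derivative f (at x) v)"
    by (cases k) auto
  with snoc.prems show ?case
    using snoc.IH[of j "\<lambda>x. frechet_derivative f (at x) v"] by (simp add: iter_deriv_snoc)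
qed

text \<open>Lagrange's form of the remainder is a scalar statement, so the vector case is reduced to
  it by pairing with the direction of the remainder itself. Both signs of \<open>s\<close> are
  covered, so that expansions at opposite points can be compared.\<close>

lemma taylor_along_line:
  fixes f :: "'a::euclidean_space \<Rightarrow> 'b::euclidean_space" and s :: real
  assumes f: "Ck_on j S f" and k: "0 < k" "k \<le> j" and s: "s \<noteq> 0"
    and seg: "\<And>t. t \<in> closed_segment 0 s \<Longrightarrow> z + t *\<^sub>R v \<in> S"
    and bound: "\<And>x. x \<in> S \<Longrightarrow> norm (iter_deriv f (replicate k v) x) \<le> C"
  shows "norm (f (z + s *\<^sub>R v) - (\<Sum>m<k. (s ^ m / fact m) *\<^sub>R iter_deriv f (replicate m v) z))
    \<le> C * \<bar>s\<bar> ^ k / fact k"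
proof -
  define R where
    "R = f (z + s *\<^sub>R v) - (\<Sum>m<k. (s ^ m / fact m) *\<^sub>R iter_deriv f (replicate m v) z)"
  \<comment> \<open>The unit vector along the remainder (zero if the remainder is zero), so that
    \<open>w \<bullet> R = norm R\<close>.\<close>
  define w where "w = sgn R"
  define F where "F m t = w \<bullet> iter_deriv f (replicate m v) (z + t *\<^sub>R v)" for m t
  have der: "DERIV (F m) t :> F (Suc m) t" if "m < k" "min 0 s \<le> t" "t \<le> max 0 s" for m t
  proof -
    let ?G = "iter_deriv f (replicate m v)"
    have "t \<in> closed_segment 0 s"
      using that by (auto simp: closed_segment_eq_real_ivl)
    then have "?G differentiable (at (z + t *\<^sub>R v))"
      using that k by (intro iter_deriv_differentiable[OF f] seg) auto
    then have d: "(?G has_derivative frechet_derivative ?G (at (z + t *\<^sub>R v))) (at (z + t *\<^sub>R v))"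
      by (simp add: frechet_derivative_works)
    have l: "((\<lambda>t. z + t *\<^sub>R v) has_derivative (\<lambda>r. r *\<^sub>R v)) (at t)"
      by (auto intro!: derivative_eq_intros)
    have lin: "linear (frechet_derivative ?G (at (z + t *\<^sub>R v)))"
      using d by (rule has_derivative_linear)
    have "((\<lambda>t. w \<bullet> ?G (z + t *\<^sub>R v)) has_derivative
        (\<lambda>r. w \<bullet> frechet_derivative ?G (at (z + t *\<^sub>R v)) (r *\<^sub>R v))) (at t)"
      using has_derivative_inner_right[OF has_derivative_compose[OF l d], of w] .
    then show ?thesis
      unfolding F_def has_field_derivative_def
      by (simp add: linear_scale[OF lin] mult_commute_abs)
  qed
  obtain t where t: "if s < 0 then s < t \<and> t < 0 else 0 < t \<and> t < s"
    and Ft: "F 0 s = (\<Sum>m<k. (F m 0 / fact m) * (s - 0) ^ m) + (F k t / fact k) * (s - 0) ^ k"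
    using Taylor[of k F "F 0" "min 0 s" "max 0 s" 0 s] der k s by auto
  have tS: "z + t *\<^sub>R v \<in> S"
    using t by (intro seg) (auto simp: closed_segment_eq_real_ivl split: if_splits)
  have "norm R = w \<bullet> R"
    by (cases "R = 0")
       (simp_all add: w_def sgn_div_norm power2_norm_eq_inner[symmetric] power2_eq_square)
  also have "\<dots> = (F k t / fact k) * s ^ k"
    using Ft by (simp add: R_def F_def inner_diff_right inner_sum_right iter_deriv_Nil mult.commute)
  also have "\<dots> \<le> \<bar>F k t / fact k * s ^ k\<bar>"
    by (rule abs_ge_self)
  also have "\<dots> = \<bar>F k t\<bar> * \<bar>s\<bar> ^ k / fact k"
    by (simp add: abs_mult power_abs)
  also have "\<dots> \<le> C * \<bar>s\<bar> ^ k / fact k"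
  proof -
    have "\<bar>F k t\<bar> \<le> norm w * norm (iter_deriv f (replicate k v) (z + t *\<^sub>R v))"
      unfolding F_def by (rule Cauchy_Schwarz_ineq2)
    also have "\<dots> \<le> 1 * C"
      by (intro mult_mono bound tS) (auto simp: w_def norm_sgn)
    finally show ?thesis by (simp add: divide_right_mono mult_right_mono)
  qed
  finally show ?thesis unfolding R_def .
qed

lemma first_order_remainder:
  fixes f :: "'a::euclidean_space \<Rightarrow> 'b::euclidean_space"
  assumes S: "convex S" "z \<in> S" "z + v \<in> S" and f: "Ck_on j S f" "2 \<le> j"
    and bound: "\<And>x vs. x \<in> S \<Longrightarrow> length vs = 2 \<Longrightarrow>
      norm (iter_deriv f vs x) \<le> B * prod_list (map norm vs)"
  shows "norm (f (z + v) - f z - frechet_derivative f (at z) v) \<le> B * (norm v)\<^sup>2 / 2"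
proof -
  have seg: "z + t *\<^sub>R v \<in> S" if "t \<in> closed_segment 0 1" for t :: real
    using that convexD_alt[OF S, of t] by (auto simp: closed_segment_eq_real_ivl algebra_simps)
  have "norm (f (z + 1 *\<^sub>R v) - (\<Sum>m<2. (1 ^ m / fact m) *\<^sub>R iter_deriv f (replicate m v) z))
      \<le> B * (norm v)\<^sup>2 * \<bar>1\<bar> ^ 2 / fact 2"
  proof (rule taylor_along_line[OF f(1) _ f(2) _ seg])
    show "norm (iter_deriv f (replicate 2 v) x) \<le> B * (norm v)\<^sup>2" if "x \<in> S" for x
      using bound[OF that, of "replicate 2 v"] by (simp add: numeral_2_eq_2)
  qed auto
  then show ?thesis by (simp add: numeral_2_eq_2 iter_deriv_Nil diff_diff_eq)
qed

text \<open>The terms of order zero and two agree at \<open>z + v\<close> and \<open>z - v\<close>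
  and cancel in the difference; each side contributes a third-order remainder of at most
  \<open>B * norm v ^ 3 / 6\<close>.\<close>

lemma central_difference_remainder:
  fixes f :: "'a::euclidean_space \<Rightarrow> 'b::euclidean_space"
  assumes S: "convex S" "z \<in> S" "z + v \<in> S" "z - v \<in> S" and f: "Ck_on j S f" "3 \<le> j"
    and bound: "\<And>x vs. x \<in> S \<Longrightarrow> length vs = 3 \<Longrightarrow>
      norm (iter_deriv f vs x) \<le> B * prod_list (map norm vs)"
  shows "norm (f (z + v) - f (z - v) - 2 *\<^sub>R frechet_derivative f (at z) v) \<le> B * norm v ^ 3 / 3"
proof -
  have seg: "z + t *\<^sub>R v \<in> S" if "t \<in> closed_segment 0 s" "s = 1 \<or> s = -1" for s t :: real
  proof (cases "0 \<le> t")
    case True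
    then show ?thesis
      using that convexD_alt[OF S(1-3), of t] by (auto simp: closed_segment_eq_real_ivl algebra_simps)
  next
    case False
    then show ?thesis
      using that convexD_alt[OF S(1,2,4), of "-t"]
      by (auto simp: closed_segment_eq_real_ivl algebra_simps)
  qed
  define T where "T s = (\<Sum>m<3. (s ^ m / fact m) *\<^sub>R iter_deriv f (replicate m v) z)" for s :: real
  have T: "norm (f (z + s *\<^sub>R v) - T s) \<le> B * norm v ^ 3 / 6" if "s = 1 \<or> s = -1" for s :: real
  proof -
    have "norm (f (z + s *\<^sub>R v) - T s) \<le> B * norm v ^ 3 * \<bar>s\<bar> ^ 3 / fact 3"
      unfolding T_def
    proof (rule taylor_along_line[OF f(1) _ f(2) _ seg])
      show "norm (iter_deriv f (replicate 3 v) x) \<le> B * norm v ^ 3" if "x \<in> S" for x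
        using bound[OF that, of "replicate 3 v"] by (simp add: numeral_3_eq_3)
    qed (use that in auto)
    then show ?thesis using that by (auto simp: numeral_3_eq_3)
  qed
  have "f (z + v) - f (z - v) - 2 *\<^sub>R frechet_derivative f (at z) v
      = (f (z + 1 *\<^sub>R v) - T 1) - (f (z + (-1) *\<^sub>R v) - T (-1))"
    by (simp add: T_def numeral_3_eq_3 iter_deriv_Nil scaleR_2 algebra_simps)
  also have "norm \<dots> \<le> B * norm v ^ 3 / 6 + B * norm v ^ 3 / 6"
    by (intro order_trans[OF norm_triangle_ineq4] add_mono T) auto
  finally show ?thesis by simp
qed

text \<open>The directional derivative is a limit of difference quotients. Openness of
  \<open>S\<close> keeps the moving point in \<open>S\<close> for small \<open>t\<close>, where the
  Lipschitz bound controls each quotient.\<close>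

lemma frechet_derivative_norm_le_lipschitz:
  fixes f :: "'a::real_normed_vector \<Rightarrow> 'b::real_normed_vector"
  assumes L: "L-lipschitz_on S f" and S: "open S" "z \<in> S" and f: "f differentiable (at z)"
  shows "norm (frechet_derivative f (at z) v) \<le> L * norm v"
proof -
  define D where "D = frechet_derivative f (at z)"
  have d: "(f has_derivative D) (at z)"
    using f by (simp add: D_def frechet_derivative_works)
  have l: "((\<lambda>t. z + t *\<^sub>R v) has_derivative (\<lambda>r. r *\<^sub>R v)) (at 0)"
    by (auto intro!: derivative_eq_intros)
  have "((\<lambda>t. f (z + t *\<^sub>R v)) has_derivative (\<lambda>r. D (r *\<^sub>R v))) (at 0)"
    using has_derivative_compose[OF l, of f D] d by simp
  then have "((\<lambda>t. norm (f (z + t *\<^sub>R v) - f z - t *\<^sub>R D v) / norm t) \<longlongrightarrow> 0) (at 0)"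
    by (simp add: has_derivative_at linear_scale[OF has_derivative_linear[OF d]])
  \<comment> \<open>The punctured neighbourhood supplies \<open>t \<noteq> 0\<close>, which permits
    moving the division inside the norm.\<close>
  moreover have "\<forall>\<^sub>F t in at 0. norm (f (z + t *\<^sub>R v) - f z - t *\<^sub>R D v) / norm t
      = norm ((f (z + t *\<^sub>R v) - f z) /\<^sub>R t - D v)"
    using eventually_at_ball'[OF zero_less_one, of 0 UNIV]
  proof eventually_elim
    case (elim t)
    then have eq: "(f (z + t *\<^sub>R v) - f z) /\<^sub>R t - D v = (f (z + t *\<^sub>R v) - f z - t *\<^sub>R D v) /\<^sub>R t"
      by (simp add: scaleR_diff_right)
    show ?case unfolding eq by (simp add: divide_inverse mult.commute)
  qed
  ultimately have "((\<lambda>t. norm ((f (z + t *\<^sub>R v) - f z) /\<^sub>R t - D v)) \<longlongrightarrow> 0) (at 0)"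
    by (rule Lim_transform_eventually)
  then have lim: "((\<lambda>t. (f (z + t *\<^sub>R v) - f z) /\<^sub>R t) \<longlongrightarrow> D v) (at 0)"
    by (rule LIM_zero_cancel[OF tendsto_norm_zero_cancel])
  have "\<forall>\<^sub>F t in at 0. z + t *\<^sub>R v \<in> S"
  proof (rule topological_tendstoD[OF _ S(1)])
    show "((\<lambda>t. z + t *\<^sub>R v) \<longlongrightarrow> z) (at 0)"
      by (auto intro!: tendsto_eq_intros)
  qed (use S in simp)
  then have "\<forall>\<^sub>F t in at 0. norm ((f (z + t *\<^sub>R v) - f z) /\<^sub>R t) \<le> L * norm v"
    using eventually_at_ball'[OF zero_less_one, of 0 UNIV]
  proof eventually_elim
    case (elim t)
    then have "t \<noteq> 0" by simp
    have "norm (f (z + t *\<^sub>R v) - f z) \<le> L * norm (t *\<^sub>R v)"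
      using lipschitz_onD[OF L elim(1) S(2)] by (simp add: dist_norm)
    then have "norm (f (z + t *\<^sub>R v) - f z) / \<bar>t\<bar> \<le> L * norm v"
      using \<open>t \<noteq> 0\<close> by (simp add: pos_divide_le_eq mult_ac)
    then show ?case by (simp only: norm_scaleR abs_inverse divide_inverse mult.commute)
  qed
  from tendsto_upperbound[OF tendsto_norm[OF lim] this] show ?thesis
    by (simp add: D_def)
qed

subsection \<open>Weighted least squares and truncation\<close>

lemma norm_sq_vec: "(norm (x :: real ^ 'n))\<^sup>2 = (\<Sum>i\<in>UNIV. (x $ i)\<^sup>2)"
  by (simp add: norm_vec_def L2_set_def sum_nonneg)

text \<open>Along any line the loss is a quadratic polynomial in \<open>t\<close>, so minimality can
  be exploited algebraically through the linear coefficient, which pairs the residuals with the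
  direction.\<close>

lemma loss_perturbation:
  "local_linear_loss K h n u y (b + t *\<^sub>R p, A + t *\<^sub>R P) =
    local_linear_loss K h n u y (b, A)
    - t * (2 * (\<Sum>i=1..n. K (u i) * ((y i - b - h *\<^sub>R (A *v u i)) \<bullet> (p + h *\<^sub>R (P *v u i)))))
    + t\<^sup>2 * (\<Sum>i=1..n. K (u i) * (norm (p + h *\<^sub>R (P *v u i)))\<^sup>2)"
proof -
  define r where "r i = y i - b - h *\<^sub>R (A *v u i)" for i
  define q where "q i = p + h *\<^sub>R (P *v u i)" for i
  have res: "y i - (b + t *\<^sub>R p) - h *\<^sub>R ((A + t *\<^sub>R P) *v u i) = r i - t *\<^sub>R q i" for i
    by (simp add: r_def q_def matrix_vector_mult_add_rdistrib scaleR_matrix_vector_assoc[symmetric]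
        algebra_simps)
  have sq: "K (u i) * (norm (r i - t *\<^sub>R q i))\<^sup>2 = K (u i) * (norm (r i))\<^sup>2
      - t * (2 * (K (u i) * (r i \<bullet> q i))) + t\<^sup>2 * (K (u i) * (norm (q i))\<^sup>2)" for i
    unfolding power2_norm_eq_inner
    by (simp add: inner_diff_left inner_diff_right inner_commute[of "q i" "r i"] power2_eq_square
        algebra_simps)
  show ?thesis
    unfolding local_linear_loss_def prod.case res sq r_def[symmetric] q_def[symmetric]
    by (simp add: sum.distrib sum_subtractf sum_distrib_left)
qed

lemma linear_coefficient_zero:
  fixes \<alpha> \<beta> :: real
  assumes "0 \<le> \<alpha>" and ge: "\<And>t. 0 \<le> t\<^sup>2 * \<alpha> - t * \<beta>"
  shows "\<beta> = 0"
proof (rule ccontr)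
  assume "\<beta> \<noteq> 0"
  \<comment> \<open>The summand 1 keeps the denominator positive also for
    \<open>\<alpha> = 0\<close>; at this point the quadratic takes the value
    \<open>- (t\<^sup>2)\<close>.\<close>
  define t where "t = \<beta> / (\<alpha> + 1)"
  have "\<beta> = t * (\<alpha> + 1)" "t \<noteq> 0"
    using \<open>0 \<le> \<alpha>\<close> \<open>\<beta> \<noteq> 0\<close> by (simp_all add: t_def)
  then have "t\<^sup>2 * \<alpha> - t * \<beta> = - (t\<^sup>2)"
    by (simp add: power2_eq_square algebra_simps)
  then show False using ge[of t] \<open>t \<noteq> 0\<close> by simp
qed

lemma residual_orthogonality:
  assumes K: "\<And>u. 0 \<le> K u"
    and min: "is_arg_min (local_linear_loss K h n u y) (\<lambda>_. True) (b, A)"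
  shows "(\<Sum>i=1..n. K (u i) * ((y i - b - h *\<^sub>R (A *v u i)) \<bullet> (p + h *\<^sub>R (P *v u i)))) = 0"
proof -
  have "2 * (\<Sum>i=1..n. K (u i) * ((y i - b - h *\<^sub>R (A *v u i)) \<bullet> (p + h *\<^sub>R (P *v u i)))) = 0"
  proof (rule linear_coefficient_zero)
    show "0 \<le> (\<Sum>i=1..n. K (u i) * (norm (p + h *\<^sub>R (P *v u i)))\<^sup>2)"
      by (intro sum_nonneg mult_nonneg_nonneg K) auto
    fix t
    have "\<not> local_linear_loss K h n u y (b + t *\<^sub>R p, A + t *\<^sub>R P) < local_linear_loss K h n u y (b, A)"
      using min unfolding is_arg_min_def by blast
    then show "0 \<le> t\<^sup>2 * (\<Sum>i=1..n. K (u i) * (norm (p + h *\<^sub>R (P *v u i)))\<^sup>2)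
      - t * (2 * (\<Sum>i=1..n. K (u i) * ((y i - b - h *\<^sub>R (A *v u i)) \<bullet> (p + h *\<^sub>R (P *v u i)))))"
      unfolding loss_perturbation by linarith
  qed
  then show ?thesis by simp
qed

text \<open>The unknown of the \<open>k\<close>-th row of the normal equations: intercept error \<open>\<beta>\<close> and slope error \<open>\<Delta>\<close>,
  the latter rescaled by \<open>h\<close> so that the design enters through \<open>\<psi>\<close> only.\<close>

definition error_row :: "real \<Rightarrow> real ^ 'l \<Rightarrow> real ^ 'd ^ 'l \<Rightarrow> 'l \<Rightarrow> real ^ ('d option)" where
  "error_row h \<beta> \<Delta> k = (\<chi> q. case q of None \<Rightarrow> \<beta> $ k | Some j \<Rightarrow> h * \<Delta> $ k $ j)"

lemma sum_option:
  fixes f :: "'a::finite option \<Rightarrow> 'b::comm_monoid_add"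
  shows "(\<Sum>q\<in>UNIV. f q) = f None + (\<Sum>j\<in>UNIV. f (Some j))"
  by (simp add: UNIV_option_conv sum.reindex)

lemma \<psi>_nth: "\<psi> u $ None = 1" "\<psi> u $ Some j = u $ j"
  by (simp_all add: \<psi>_def)

lemma error_row_inner_\<psi>:
  "error_row h \<beta> \<Delta> k \<bullet> \<psi> u = (\<beta> + h *\<^sub>R (\<Delta> *v u)) $ k"
  by (simp add: inner_vec_def sum_option error_row_def \<psi>_nth matrix_vector_mult_def
      sum_distrib_left mult.assoc)

text \<open>Orthogonality is tested against a change of the \<open>k\<close>-th intercept coordinate
  (case \<open>None\<close>) or of a single slope entry in row \<open>k\<close> (case
  \<open>Some j\<close>). Passing from the fit to the reference pair \<open>b'\<close>,
  \<open>A'\<close> changes coordinate \<open>k\<close> of each residual by the inner product of the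
  error row with \<psi>.\<close>

lemma normal_equations:
  fixes b b' :: "real ^ 'l" and A A' :: "real ^ 'd ^ 'l"
  assumes K: "\<And>u. 0 \<le> K u" and h: "h \<noteq> 0"
    and min: "is_arg_min (local_linear_loss K h n u y) (\<lambda>_. True) (b, A)"
  shows "(\<Sum>i=1..n. K (u i) * \<psi> (u i) $ p * (y i - b' - h *\<^sub>R (A' *v u i)) $ k)
    = (\<Sum>q\<in>UNIV. (\<Sum>i=1..n. K (u i) * \<psi> (u i) $ p * \<psi> (u i) $ q) *
        error_row h (b - b') (A - A') k $ q)"
proof -
  have 0: "(\<Sum>i=1..n. K (u i) * \<psi> (u i) $ p * (y i - b - h *\<^sub>R (A *v u i)) $ k) = 0"
  proof (cases p)
    case None
    have "(\<Sum>i=1..n. K (u i) * ((y i - b - h *\<^sub>R (A *v u i)) \<bullet> (axis k 1 + h *\<^sub>R (0 *v u i)))) = 0"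
      by (rule residual_orthogonality[OF K min])
    then show ?thesis using None by (simp add: \<psi>_nth inner_axis)
  next
    case (Some j)
    \<comment> \<open>The matrix unit at row \<open>k\<close>, column \<open>j\<close>; the common
      factor \<open>h\<close> that it produces is cancelled because
      \<open>h \<noteq> 0\<close>.\<close>
    define P :: "real ^ 'd ^ 'l" where "P = (\<chi> a b. if a = k \<and> b = j then 1 else 0)"
    have P: "h *\<^sub>R (P *v v) = (h * v $ j) *\<^sub>R axis k 1" for v
      by (auto simp: P_def vec_eq_iff matrix_vector_mult_def axis_def if_distribR
          if_distrib[where f = "\<lambda>x. x * _"] cong: if_cong)
    have "(\<Sum>i=1..n. K (u i) * ((y i - b - h *\<^sub>R (A *v u i)) \<bullet> (0 + h *\<^sub>R (P *v u i)))) = 0"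
      by (rule residual_orthogonality[OF K min])
    then have "h * (\<Sum>i=1..n. K (u i) * u i $ j * (y i - b - h *\<^sub>R (A *v u i)) $ k) = 0"
      by (simp add: P inner_axis sum_distrib_left mult_ac)
    then show ?thesis using Some h by (simp add: \<psi>_nth)
  qed
  have "K (u i) * \<psi> (u i) $ p * (y i - b' - h *\<^sub>R (A' *v u i)) $ k =
      K (u i) * \<psi> (u i) $ p * (y i - b - h *\<^sub>R (A *v u i)) $ k +
      (\<Sum>q\<in>UNIV. K (u i) * \<psi> (u i) $ p * \<psi> (u i) $ q * error_row h (b - b') (A - A') k $ q)" for i
  proof -
    have "(\<Sum>q\<in>UNIV. K (u i) * \<psi> (u i) $ p * \<psi> (u i) $ q * error_row h (b - b') (A - A') k $ q)
        = K (u i) * \<psi> (u i) $ p * (error_row h (b - b') (A - A') k \<bullet> \<psi> (u i))"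
      by (simp add: inner_vec_def sum_distrib_left mult_ac)
    also have "\<dots> = K (u i) * \<psi> (u i) $ p * ((b - b') + h *\<^sub>R ((A - A') *v u i)) $ k"
      by (simp only: error_row_inner_\<psi>)
    finally show ?thesis
      by (simp add: matrix_vector_mult_diff_rdistrib algebra_simps)
  qed
  then have "(\<Sum>i=1..n. K (u i) * \<psi> (u i) $ p * (y i - b' - h *\<^sub>R (A' *v u i)) $ k) =
      (\<Sum>i=1..n. \<Sum>q\<in>UNIV.
        K (u i) * \<psi> (u i) $ p * \<psi> (u i) $ q * error_row h (b - b') (A - A') k $ q)"
    by (simp only: sum.distrib 0 add_0)
  then show ?thesis by (subst (asm) sum.swap) (simp add: sum_distrib_right)
qed

section \<open>Operator norm and truncation\<close>

lemma op_norm_nonneg: "0 \<le> op_norm A"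
  unfolding op_norm_def by (rule onorm_pos_le) simp

lemma op_norm_add: "op_norm (A + B) \<le> op_norm A + op_norm B"
  unfolding op_norm_def matrix_vector_mult_add_rdistrib by (rule onorm_triangle) auto

lemma op_norm_scaleR: "op_norm (r *\<^sub>R A) = \<bar>r\<bar> * op_norm A"
  unfolding op_norm_def scaleR_matrix_vector_assoc[symmetric] by (rule onorm_scaleR) auto

lemma op_norm_minus: "op_norm (- A) = op_norm A"
  using op_norm_scaleR[of "-1" A] by simp

lemma op_norm_eq_0: "op_norm A = 0 \<longleftrightarrow> A = 0"
  unfolding op_norm_def by (subst onorm_eq_0) (auto, metis matrix_eq matrix_vector_mult_0)

text \<open>The right-hand side is the squared Frobenius norm, which dominates the operator norm by
  Cauchy-Schwarz in each row.\<close>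

lemma op_norm_sq_le_entries:
  fixes A :: "real ^ 'd ^ 'l"
  shows "(op_norm A)\<^sup>2 \<le> (\<Sum>k\<in>UNIV. \<Sum>j\<in>UNIV. (A $ k $ j)\<^sup>2)"
proof -
  have fro: "(\<Sum>k\<in>UNIV. \<Sum>j\<in>UNIV. (A $ k $ j)\<^sup>2) = (norm A)\<^sup>2"
    by (simp add: norm_vec_def[of A] L2_set_def sum_nonneg norm_sq_vec)
  have "norm (A *v x) \<le> norm A * norm x" for x
  proof -
    have "(norm (A *v x))\<^sup>2 = (\<Sum>k\<in>UNIV. (A $ k \<bullet> x)\<^sup>2)"
      unfolding norm_sq_vec[of "A *v x"] by (simp add: matrix_vector_mult_def inner_vec_def)
    also have "\<dots> \<le> (\<Sum>k\<in>UNIV. (norm (A $ k))\<^sup>2 * (norm x)\<^sup>2)"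
      by (intro sum_mono) (metis Cauchy_Schwarz_ineq power2_norm_eq_inner)
    also have "\<dots> = (norm A * norm x)\<^sup>2"
      by (simp add: power_mult_distrib norm_sq_vec fro[symmetric] sum_distrib_right)
    finally show ?thesis by (rule power2_le_imp_le) simp
  qed
  then have "op_norm A \<le> norm A"
    unfolding op_norm_def by (intro onorm_le) auto
  then show ?thesis unfolding fro by (intro power_mono op_norm_nonneg)
qed

lemma op_norm_truncate:
  assumes "0 \<le> L" shows "op_norm (truncate L A) \<le> L"
proof (cases "A = 0")
  case False
  then have "0 < op_norm A"
    using op_norm_nonneg[of A] op_norm_eq_0[of A] by linarith
  with \<open>0 \<le> L\<close> have "\<bar>min 1 (L / op_norm A)\<bar> * op_norm A \<le> L"
    by (simp add: abs_of_nonneg min_def field_simps)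
  with False show ?thesis by (simp add: truncate_def op_norm_scaleR)
next
  case True
  then have "op_norm (truncate L A) = 0" by (simp add: truncate_def op_norm_eq_0)
  with \<open>0 \<le> L\<close> show ?thesis by simp
qed

text \<open>Truncation moves \<open>A\<close> by \<open>op_norm A - L\<close> if this is positive
  and not at all otherwise. Since \<open>op_norm J \<le> L\<close>, the displacement is at most
  \<open>op_norm (A - J)\<close>, and the triangle inequality gives the factor 2.\<close>

lemma truncate_error_le:
  assumes J: "op_norm J \<le> L"
  shows "op_norm (truncate L A - J) \<le> 2 * op_norm (A - J)"
proof -
  have L: "0 \<le> L" using J op_norm_nonneg[of J] by linarith
  have "op_norm (truncate L A - A) \<le> op_norm (A - J)"
  proof (cases "op_norm A \<le> L")
    case True
    have "truncate L A = A"
    proof (cases "A = 0")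
      case False
      then have "0 < op_norm A"
        using op_norm_nonneg[of A] op_norm_eq_0[of A] by linarith
      with True show ?thesis by (simp add: truncate_def min_def field_simps)
    qed (simp add: truncate_def)
    then show ?thesis using op_norm_nonneg[of "A - J"] op_norm_eq_0[of "truncate L A - A"] by simp
  next
    case False
    then have pos: "0 < op_norm A" "A \<noteq> 0"
      using L op_norm_eq_0[of A] by auto
    with False have "truncate L A = (L / op_norm A) *\<^sub>R A"
      by (simp add: truncate_def min_def field_simps)
    then have "truncate L A - A = (L / op_norm A - 1) *\<^sub>R A"
      by (simp add: algebra_simps)
    then have "op_norm (truncate L A - A) = \<bar>L / op_norm A - 1\<bar> * op_norm A"
      by (simp add: op_norm_scaleR)
    also have "\<dots> = op_norm A - L"
      using False pos by (simp add: abs_if field_simps)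
    also have "\<dots> \<le> op_norm (A - J)"
      using op_norm_add[of "A - J" J] J by simp
    finally show ?thesis .
  qed
  then show ?thesis
    using op_norm_add[of "truncate L A - A" "A - J"] by simp
qed

text \<open>Off-diagonal blocks of \<open>S\<close> vanish, so the gradient block \<open>Some j\<close> decouples from the
  intercept \<open>None\<close>: only the gradient part of \<open>s\<close> enters at leading order, and the full \<open>s\<close>
  only multiplied by the deviation of \<open>T\<close> from \<open>S\<close>.\<close>

lemma slope_error_bound:
  fixes S T :: "'d::finite option \<Rightarrow> 'd option \<Rightarrow> real" and s v :: "real ^ 'd option"
  assumes eq: "\<And>p. (\<Sum>q\<in>UNIV. T p q * v $ q) = s $ p"
    and \<kappa>: "0 < \<kappa>"
    and S_ge: "\<And>x :: real ^ 'd option. \<kappa> * (norm x)\<^sup>2 \<le> (\<Sum>p\<in>UNIV. \<Sum>q\<in>UNIV. x $ p * S p q * x $ q)"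
    and S_block: "\<And>j. S (Some j) None = 0"
    and dev: "(\<Sum>p\<in>UNIV. \<Sum>q\<in>UNIV. (T p q - S p q)\<^sup>2) \<le> (\<kappa> / 2)\<^sup>2" (is "?D \<le> _")
  shows "\<kappa>\<^sup>2 * (\<Sum>j\<in>UNIV. (v $ Some j)\<^sup>2)
    \<le> 2 * (\<Sum>j\<in>UNIV. (s $ Some j)\<^sup>2) + 8 / \<kappa>\<^sup>2 * ?D * (norm s)\<^sup>2"
proof -
  \<comment> \<open>The perturbation \<open>(T - S) v\<close>; with it \<open>v\<close> solves the
    population system with right-hand side \<open>s - Dv\<close>.\<close>
  define Dv :: "real ^ 'd option" where "Dv = (\<chi> p. \<Sum>q\<in>UNIV. (T p q - S p q) * v $ q)"
  have "(norm Dv)\<^sup>2 \<le> ?D * (norm v)\<^sup>2"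
  proof -
    have "(norm Dv)\<^sup>2 = (\<Sum>p\<in>UNIV. (\<Sum>q\<in>UNIV. (T p q - S p q) * v $ q)\<^sup>2)"
      by (simp add: Dv_def norm_sq_vec)
    also have "\<dots> \<le> (\<Sum>p\<in>UNIV. (\<Sum>q\<in>UNIV. (T p q - S p q)\<^sup>2) * (\<Sum>q\<in>UNIV. (v $ q)\<^sup>2))"
      by (intro sum_mono Cauchy_Schwarz_ineq_sum)
    finally show ?thesis
      by (simp add: norm_sq_vec sum_distrib_right)
  qed
  note Dv_le = this
  have Sv: "(\<Sum>q\<in>UNIV. S p q * v $ q) = s $ p - Dv $ p" for p
    by (simp add: Dv_def eq[symmetric] sum_subtractf left_diff_distrib)
  \<comment> \<open>Coercivity of \<open>S\<close> absorbs the perturbation: \<open>dev\<close>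
    bounds \<open>norm Dv\<close> by \<open>\<kappa> / 2 * norm v\<close>, which leaves half of the
    coercivity constant.\<close>
  have v_le: "norm v \<le> 2 / \<kappa> * norm s"
  proof -
    have "norm Dv \<le> \<kappa> / 2 * norm v"
    proof (rule power2_le_imp_le)
      show "(norm Dv)\<^sup>2 \<le> (\<kappa> / 2 * norm v)\<^sup>2"
        using Dv_le mult_right_mono[OF dev, of "(norm v)\<^sup>2"]
        by (simp add: power_mult_distrib power_divide)
    qed (use \<kappa> in simp)
    have "\<kappa> * (norm v)\<^sup>2 \<le> (\<Sum>p\<in>UNIV. v $ p * (\<Sum>q\<in>UNIV. S p q * v $ q))"
      using S_ge[of v] by (simp add: sum_distrib_left mult_ac)
    also have "\<dots> = v \<bullet> (s - Dv)"
      by (simp add: Sv inner_vec_def)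
    also have "\<dots> \<le> norm v * (norm s + norm Dv)"
      by (intro order_trans[OF norm_cauchy_schwarz] mult_left_mono norm_triangle_ineq4) auto
    also have "\<dots> \<le> norm v * (norm s + \<kappa> / 2 * norm v)"
      using \<open>norm Dv \<le> \<kappa> / 2 * norm v\<close> by (intro mult_left_mono) auto
    finally have "norm v * (\<kappa> / 2 * norm v) \<le> norm v * norm s"
      by (simp add: power2_eq_square algebra_simps)
    then show ?thesis
      using \<kappa> by (cases "v = 0") (auto simp: field_simps)
  qed
  \<comment> \<open>\<open>w\<close> and \<open>t\<close> are \<open>v\<close> and
    \<open>s - Dv\<close> with the intercept coordinate erased. As \<open>S (Some j) None\<close>
    vanishes, the intercept of \<open>v\<close> can be put back into the slope equations, so the
    quadratic form at \<open>w\<close> equals \<open>w \<bullet> t\<close>.\<close>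
  define w :: "real ^ 'd option" where "w = (\<chi> p. case p of None \<Rightarrow> 0 | Some j \<Rightarrow> v $ Some j)"
  define t :: "real ^ 'd option" where "t = (\<chi> p. case p of None \<Rightarrow> 0 | Some j \<Rightarrow> (s - Dv) $ Some j)"
  have w_sq: "(norm w)\<^sup>2 = (\<Sum>j\<in>UNIV. (v $ Some j)\<^sup>2)"
    by (simp add: norm_sq_vec sum_option w_def)
  have "\<kappa> * (norm w)\<^sup>2 \<le> (\<Sum>p\<in>UNIV. \<Sum>q\<in>UNIV. w $ p * S p q * w $ q)"
    by (rule S_ge)
  also have "\<dots> = (\<Sum>j\<in>UNIV. v $ Some j * (\<Sum>q\<in>UNIV. S (Some j) q * v $ q))"
    by (simp add: sum_option w_def S_block sum_distrib_left mult.assoc)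
  also have "\<dots> = w \<bullet> t"
    by (simp add: Sv inner_vec_def sum_option w_def t_def)
  also have "\<dots> \<le> norm w * norm t"
    by (rule norm_cauchy_schwarz)
  finally have "norm w * (\<kappa> * norm w) \<le> norm w * norm t"
    by (simp add: power2_eq_square mult_ac)
  then have "\<kappa> * norm w \<le> norm t"
    by (cases "w = 0") auto
  then have "(\<kappa> * norm w)\<^sup>2 \<le> (norm t)\<^sup>2"
    using \<kappa> by (intro power_mono) auto
  also have "\<dots> = (\<Sum>j\<in>UNIV. (s $ Some j - Dv $ Some j)\<^sup>2)"
    by (simp add: norm_sq_vec sum_option t_def)
  also have "\<dots> \<le> (\<Sum>j\<in>UNIV. 2 * (s $ Some j)\<^sup>2 + 2 * (Dv $ Some j)\<^sup>2)"
  proof (rule sum_mono)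
    fix j
    show "(s $ Some j - Dv $ Some j)\<^sup>2 \<le> 2 * (s $ Some j)\<^sup>2 + 2 * (Dv $ Some j)\<^sup>2"
      using zero_le_power2[of "s $ Some j + Dv $ Some j"] by (simp add: power2_sum power2_diff)
  qed
  also have "\<dots> \<le> 2 * (\<Sum>j\<in>UNIV. (s $ Some j)\<^sup>2) + 2 * (norm Dv)\<^sup>2"
    by (simp add: norm_sq_vec sum_option sum.distrib sum_distrib_left)
  also have "(norm Dv)\<^sup>2 \<le> ?D * (2 / \<kappa> * norm s)\<^sup>2"
    by (intro order_trans[OF Dv_le] mult_left_mono power_mono v_le) (auto intro!: sum_nonneg)
  finally show ?thesis
    by (simp add: w_sq power_mult_distrib power_divide mult_ac)
qed

subsection \<open>Empirical means\<close>

lemma borel_measurable_vec_component[measurable (raw)]: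
  fixes f :: "'a \<Rightarrow> real ^ 'n"
  assumes "f \<in> borel_measurable M"
  shows "(\<lambda>x. f x $ k) \<in> borel_measurable M"
  by (rule measurable_compose[OF assms]) (intro borel_measurable_continuous_onI continuous_intros)

lemma component_sq_le_norm_sq: "(x $ k)\<^sup>2 \<le> (norm (x :: real ^ 'n))\<^sup>2"
  using component_le_norm_cart[of x k] by (simp add: abs_le_square_iff[symmetric])

section \<open>Law and symmetry of the rescaled design points\<close>

lemma distr_standardized_design:
  fixes X :: "'w \<Rightarrow> 'a::euclidean_space" and g :: "'a \<Rightarrow> real"
  assumes h: "0 < h" and g: "\<And>u. 0 \<le> g u" "g \<in> borel_measurable borel"
    and X: "distributed M lborel X (\<lambda>x. ennreal (g ((x - z) /\<^sub>R h) / h ^ DIM('a)))"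
  shows "distr M borel (\<lambda>\<omega>. (X \<omega> - z) /\<^sub>R h) = density lborel (\<lambda>u. ennreal (g u))"
proof (rule measure_eqI)
  fix A assume "A \<in> sets (distr M borel (\<lambda>\<omega>. (X \<omega> - z) /\<^sub>R h))"
  then have A[measurable]: "A \<in> sets borel" by simp
  note g(2)[measurable]
  have X_meas[measurable]: "X \<in> borel_measurable M"
    using distributed_measurable[OF X] by simp
  have "emeasure (distr M borel (\<lambda>\<omega>. (X \<omega> - z) /\<^sub>R h)) A
      = (\<integral>\<^sup>+ u. indicator A u \<partial>distr M borel (\<lambda>\<omega>. (X \<omega> - z) /\<^sub>R h))"
    by (rule nn_integral_indicator[symmetric]) simp
  also have "\<dots> = (\<integral>\<^sup>+ \<omega>. indicator A ((X \<omega> - z) /\<^sub>R h) \<partial>M)"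
    by (rule nn_integral_distr) measurable
  also have "\<dots> = (\<integral>\<^sup>+ x. ennreal (g ((x - z) /\<^sub>R h) / h ^ DIM('a)) * indicator A ((x - z) /\<^sub>R h) \<partial>lborel)"
    by (rule distributed_nn_integral[OF X, symmetric]) measurable
  \<comment> \<open>The substitution \<open>x = z + h *\<^sub>R u\<close> has Jacobian determinant
    \<open>h ^ DIM('a)\<close>, which then cancels the normalisation of the density.\<close>
  also have "\<dots> = (\<integral>\<^sup>+ u. ennreal (h ^ DIM('a)) * (ennreal (g u / h ^ DIM('a)) * indicator A u) \<partial>lborel)"
    using h by (subst lborel_affine[of h z]) (auto simp: nn_integral_density nn_integral_distr)
  also have "\<dots> = (\<integral>\<^sup>+ u. ennreal (g u) * indicator A u \<partial>lborel)"
    using h by (intro nn_integral_cong) (simp add: mult.assoc[symmetric] ennreal_mult'[symmetric] g)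
  also have "\<dots> = emeasure (density lborel (\<lambda>u. ennreal (g u))) A"
    by (simp add: emeasure_density)
  finally show "emeasure (distr M borel (\<lambda>\<omega>. (X \<omega> - z) /\<^sub>R h)) A
    = emeasure (density lborel (\<lambda>u. ennreal (g u))) A" .
qed simp

lemma distr_uminus_lborel_euclidean:
  "distr lborel borel uminus = (lborel :: 'a::euclidean_space measure)"
  using lborel_affine[of "-1 :: real" "0 :: 'a"] by (simp add: density_1)

lemma distr_uminus_even_density:
  fixes g :: "'a::euclidean_space \<Rightarrow> real"
  assumes [measurable]: "g \<in> borel_measurable borel" and even: "\<And>u. g (- u) = g u"
  shows "distr (density lborel (\<lambda>u. ennreal (g u))) borel uminus = density lborel (\<lambda>u. ennreal (g u))"
proof -
  have "distr (density lborel (\<lambda>u. ennreal (g (- u)))) borel uminus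
      = density (distr lborel borel uminus) (\<lambda>u. ennreal (g u))"
    by (rule density_distr[symmetric]) auto
  then show ?thesis by (simp add: even distr_uminus_lborel_euclidean)
qed

section \<open>Independence and second moments of sums\<close>

lemma preimages_compose_subset:
  assumes f[measurable]: "f \<in> measurable R N" and W[measurable]: "W \<in> measurable M R"
  shows "{(\<lambda>\<omega>. f (W \<omega>)) -` A \<inter> space M | A. A \<in> sets N} \<subseteq> {W -` A \<inter> space M | A. A \<in> sets R}"
proof safe
  fix A assume "A \<in> sets N"
  then have "f -` A \<inter> space R \<in> sets R" by (rule measurable_sets[OF f])
  moreover have "(\<lambda>\<omega>. f (W \<omega>)) -` A \<inter> space M = W -` (f -` A \<inter> space R) \<inter> space M"
    using measurable_space[OF W] by auto
  ultimately show "\<exists>B. (\<lambda>\<omega>. f (W \<omega>)) -` A \<inter> space M = W -` B \<inter> space M \<and> B \<in> sets R"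
    by blast
qed

context prob_space
begin

text \<open>Expanding the square leaves only the diagonal, since cross terms have expectation zero.
  Formulating this through orthogonality serves both the centred design averages and the noise
  averages.\<close>

lemma expectation_sq_sum_le:
  fixes Z :: "'i \<Rightarrow> 'a \<Rightarrow> real" and V :: real
  assumes I: "finite I"
    and Z[measurable]: "\<And>i. i \<in> I \<Longrightarrow> random_variable borel (Z i)"
    and sq: "\<And>i. i \<in> I \<Longrightarrow> integrable M (\<lambda>\<omega>. (Z i \<omega>)\<^sup>2)"
    and V: "\<And>i. i \<in> I \<Longrightarrow> expectation (\<lambda>\<omega>. (Z i \<omega>)\<^sup>2) \<le> V"
    and orth: "\<And>i j. i \<in> I \<Longrightarrow> j \<in> I \<Longrightarrow> i \<noteq> j \<Longrightarrow> expectation (\<lambda>\<omega>. Z i \<omega> * Z j \<omega>) = 0"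
  shows "integrable M (\<lambda>\<omega>. (\<Sum>i\<in>I. Z i \<omega>)\<^sup>2)"
    and "expectation (\<lambda>\<omega>. (\<Sum>i\<in>I. Z i \<omega>)\<^sup>2) \<le> card I * V"
proof -
  have int: "integrable M (\<lambda>\<omega>. Z i \<omega> * Z j \<omega>)" if "i \<in> I" "j \<in> I" for i j
  proof (rule Bochner_Integration.integrable_bound)
    show "integrable M (\<lambda>\<omega>. (Z i \<omega>)\<^sup>2 + (Z j \<omega>)\<^sup>2)"
      using sq that by auto
    have "\<bar>a * b\<bar> \<le> a\<^sup>2 + b\<^sup>2" for a b :: real
      using sum_squares_bound[of "\<bar>a\<bar>" "\<bar>b\<bar>"] mult_nonneg_nonneg[of "\<bar>a\<bar>" "\<bar>b\<bar>"]
      unfolding abs_mult power2_abs by linarith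
    then show "AE \<omega> in M. norm (Z i \<omega> * Z j \<omega>) \<le> norm ((Z i \<omega>)\<^sup>2 + (Z j \<omega>)\<^sup>2)"
      by (auto simp: abs_of_nonneg)
  qed (use that in measurable)
  have expand: "(\<Sum>i\<in>I. Z i \<omega>)\<^sup>2 = (\<Sum>i\<in>I. \<Sum>j\<in>I. Z i \<omega> * Z j \<omega>)" for \<omega>
    by (simp add: power2_eq_square sum_product)
  show "integrable M (\<lambda>\<omega>. (\<Sum>i\<in>I. Z i \<omega>)\<^sup>2)"
    unfolding expand using int by auto
  have "expectation (\<lambda>\<omega>. (\<Sum>i\<in>I. Z i \<omega>)\<^sup>2) = (\<Sum>i\<in>I. \<Sum>j\<in>I. expectation (\<lambda>\<omega>. Z i \<omega> * Z j \<omega>))"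
    unfolding expand using int by (simp add: Bochner_Integration.integral_sum)
  also have "\<dots> = (\<Sum>i\<in>I. \<Sum>j\<in>I. if i = j then expectation (\<lambda>\<omega>. (Z i \<omega>)\<^sup>2) else 0)"
    by (intro sum.cong refl) (auto simp: orth power2_eq_square)
  also have "\<dots> = (\<Sum>i\<in>I. expectation (\<lambda>\<omega>. (Z i \<omega>)\<^sup>2))"
    using I by simp
  also have "\<dots> \<le> card I * V"
    using V by (rule sum_bounded_above)
  finally show "expectation (\<lambda>\<omega>. (\<Sum>i\<in>I. Z i \<omega>)\<^sup>2) \<le> card I * V" .
qed

lemma indep_set_mono:
  assumes "indep_set A B" "A' \<subseteq> A" "B' \<subseteq> B"
  shows "indep_set A' B'"
  using assms unfolding indep_sets2_eq by blast

lemma indep_var_preimages: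
  "indep_var S X T Y \<longleftrightarrow> (random_variable S X \<and> random_variable T Y) \<and>
    indep_set {X -` A \<inter> space M | A. A \<in> sets S} {Y -` A \<inter> space M | A. A \<in> sets T}"
  unfolding indep_var_def indep_vars_def2 indep_set_def UNIV_bool
  by (intro arg_cong2[where f = "(\<and>)"] arg_cong2[where f = indep_sets] ext)
     (auto split: bool.split)

text \<open>Real functions of the two blocks have a common value type and generate smaller
  sigma-algebras, so the product rule for expectations becomes applicable to them.\<close>

lemma indep_rv_indep_var_compose:
  assumes XY: "indep_rv M S X T Y" and [measurable]: "F \<in> measurable S borel" "H \<in> measurable T borel"
  shows "indep_var borel (\<lambda>\<omega>. F (X \<omega>)) borel (\<lambda>\<omega>. H (Y \<omega>))"
proof -
  have [measurable]: "X \<in> measurable M S" "Y \<in> measurable M T"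
    and ind: "indep_set {X -` A \<inter> space M | A. A \<in> sets S} {Y -` B \<inter> space M | B. B \<in> sets T}"
    using XY by (auto simp: indep_rv_def)
  have "indep_set {(\<lambda>\<omega>. F (X \<omega>)) -` A \<inter> space M | A. A \<in> sets borel}
      {(\<lambda>\<omega>. H (Y \<omega>)) -` A \<inter> space M | A. A \<in> sets borel}"
    by (rule indep_set_mono[OF ind]; rule preimages_compose_subset) measurable
  then show ?thesis
    by (simp add: indep_var_preimages)
qed

end


lemma integral_distr_cong:
  fixes f :: "'b \<Rightarrow> real"
  assumes "distr M N X = distr M' N Y" "X \<in> measurable M N" "Y \<in> measurable M' N"
    and "f \<in> borel_measurable N"
  shows "integrable M (\<lambda>\<omega>. f (X \<omega>)) \<longleftrightarrow> integrable M' (\<lambda>\<omega>. f (Y \<omega>))"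
    and "integral\<^sup>L M (\<lambda>\<omega>. f (X \<omega>)) = integral\<^sup>L M' (\<lambda>\<omega>. f (Y \<omega>))"
  using assms integrable_distr_eq[of X M N f] integrable_distr_eq[of Y M' N f]
    integral_distr[of X M N f] integral_distr[of Y M' N f] by (simp_all add: o_def)

text \<open>\<open>U\<close> models the standardized design points with common law \<open>P\<close>.
  Independence is between the whole noise vector and the whole design vector, so that products over
  two indices can be separated into a noise factor and a design factor.\<close>

locale regression_sample = prob_space M
  for M :: "'w measure" and n :: nat and P :: "'a::euclidean_space measure"
    and U :: "nat \<Rightarrow> 'w \<Rightarrow> 'a" and e :: "nat \<Rightarrow> 'w \<Rightarrow> real ^ 'l" and \<epsilon> :: "'w \<Rightarrow> real ^ 'l" +
  assumes n: "1 \<le> n"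
    and U_indep: "indep_vars (\<lambda>_. borel) U {1..n}"
    and U_distr: "\<And>i. i \<in> {1..n} \<Longrightarrow> distr M borel (U i) = P"
    and e_indep: "indep_vars (\<lambda>_. borel) e {1..n}"
    and e_distr: "\<And>i. i \<in> {1..n} \<Longrightarrow> distr M borel (e i) = distr M borel \<epsilon>"
    and joint_indep: "indep_rv M
      (\<Pi>\<^sub>M i\<in>{1..n}. borel) (\<lambda>\<omega>. \<lambda>i\<in>{1..n}. e i \<omega>)
      (\<Pi>\<^sub>M i\<in>{1..n}. borel) (\<lambda>\<omega>. \<lambda>i\<in>{1..n}. U i \<omega>)"
    and \<epsilon>_measurable[measurable]: "\<epsilon> \<in> borel_measurable M"
    and \<epsilon>_sq_integrable: "integrable M (\<lambda>\<omega>. (norm (\<epsilon> \<omega>))\<^sup>2)"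
    and \<epsilon>_mean: "integral\<^sup>L M \<epsilon> = 0"
begin

definition \<sigma>2 :: real where "\<sigma>2 = expectation (\<lambda>\<omega>. (norm (\<epsilon> \<omega>))\<^sup>2)"

definition avg :: "('a \<Rightarrow> real) \<Rightarrow> 'w \<Rightarrow> real" where
  "avg f \<omega> = (\<Sum>i=1..n. f (U i \<omega>)) / n"

definition avg_noise :: "('a \<Rightarrow> real) \<Rightarrow> 'l \<Rightarrow> 'w \<Rightarrow> real" where
  "avg_noise f k \<omega> = (\<Sum>i=1..n. f (U i \<omega>) * e i \<omega> $ k) / n"

lemma U_measurable[measurable]: "i \<in> {1..n} \<Longrightarrow> U i \<in> borel_measurable M"
  using U_indep by (auto simp: indep_vars_def)

lemma e_measurable[measurable]: "i \<in> {1..n} \<Longrightarrow> e i \<in> borel_measurable M"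
  using e_indep by (auto simp: indep_vars_def)

lemma U_expectation:
  fixes f :: "'a \<Rightarrow> real"
  assumes i: "i \<in> {1..n}" and f[measurable]: "f \<in> borel_measurable borel"
  shows "expectation (\<lambda>\<omega>. f (U i \<omega>)) = (LINT u|P. f u)"
  unfolding U_distr[OF i, symmetric] by (rule integral_distr[symmetric]) (use i in measurable)

lemma \<epsilon>_integrable: "integrable M \<epsilon>"
proof (rule Bochner_Integration.integrable_bound)
  show "integrable M (\<lambda>\<omega>. 1 + (norm (\<epsilon> \<omega>))\<^sup>2)"
    using \<epsilon>_sq_integrable by auto
  have "x \<le> 1 + x\<^sup>2" for x :: real
  proof -
    have "2 * x \<le> x\<^sup>2 + 1"
      using zero_le_power2[of "x - 1"] unfolding power2_diff by simp
    moreover have "0 \<le> x\<^sup>2" by simp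
    ultimately show ?thesis by linarith
  qed
  then show "AE \<omega> in M. norm (\<epsilon> \<omega>) \<le> norm (1 + (norm (\<epsilon> \<omega>))\<^sup>2)"
    by (auto simp: abs_of_nonneg)
qed measurable

text \<open>The moments of \<epsilon> are transported along the equality of laws; the second moment
  of a coordinate is dominated by that of the norm.\<close>

lemma noise_moments:
  assumes i: "i \<in> {1..n}"
  shows "integrable M (\<lambda>\<omega>. e i \<omega> $ k)" "expectation (\<lambda>\<omega>. e i \<omega> $ k) = 0"
    and "integrable M (\<lambda>\<omega>. (e i \<omega> $ k)\<^sup>2)" "expectation (\<lambda>\<omega>. (e i \<omega> $ k)\<^sup>2) \<le> \<sigma>2"
proof -
  note tr = integral_distr_cong[OF e_distr[OF i] e_measurable[OF i] \<epsilon>_measurable]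
  have sq: "integrable M (\<lambda>\<omega>. (\<epsilon> \<omega> $ k)\<^sup>2)"
    by (rule Bochner_Integration.integrable_bound[OF \<epsilon>_sq_integrable])
       (auto simp: component_sq_le_norm_sq)
  show "integrable M (\<lambda>\<omega>. e i \<omega> $ k)"
    using tr(1)[of "\<lambda>x. x $ k"] integrable_bounded_linear[OF bounded_linear_vec_nth \<epsilon>_integrable, of k] by simp
  show "expectation (\<lambda>\<omega>. e i \<omega> $ k) = 0"
    using tr(2)[of "\<lambda>x. x $ k"] integral_bounded_linear[OF bounded_linear_vec_nth \<epsilon>_integrable, of k] \<epsilon>_mean by simp
  show "integrable M (\<lambda>\<omega>. (e i \<omega> $ k)\<^sup>2)"
    using tr(1)[of "\<lambda>x. (x $ k)\<^sup>2"] sq by simp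
  have "expectation (\<lambda>\<omega>. (e i \<omega> $ k)\<^sup>2) = expectation (\<lambda>\<omega>. (\<epsilon> \<omega> $ k)\<^sup>2)"
    using tr(2)[of "\<lambda>x. (x $ k)\<^sup>2"] by simp
  also have "\<dots> \<le> \<sigma>2"
    unfolding \<sigma>2_def using sq \<epsilon>_sq_integrable
    by (intro integral_mono component_sq_le_norm_sq)
  finally show "expectation (\<lambda>\<omega>. (e i \<omega> $ k)\<^sup>2) \<le> \<sigma>2" .
qed

lemma \<sigma>2_nonneg: "0 \<le> \<sigma>2"
  unfolding \<sigma>2_def by simp

context
  fixes f :: "'a \<Rightarrow> real" and B :: real
  assumes f[measurable]: "f \<in> borel_measurable borel" and f_le: "\<And>u. \<bar>f u\<bar> \<le> B"
begin

lemma bound_nonneg: "0 \<le> B"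
  using f_le[of 0] by linarith

lemma f_sq_le: "(f u)\<^sup>2 \<le> B\<^sup>2"
  using f_le[of u] bound_nonneg by (simp add: abs_le_square_iff[symmetric])

lemma f_U_integrable: "i \<in> {1..n} \<Longrightarrow> integrable M (\<lambda>\<omega>. f (U i \<omega>))"
  by (rule integrable_const_bound[of _ B]) (auto simp: f_le)

lemma avg_measurable[measurable]: "avg f \<in> borel_measurable M"
  unfolding avg_def[abs_def] by measurable

text \<open>The centred terms are pairwise orthogonal by independence, and centring can only lower
  the second moment, which is at most \<open>B\<^sup>2\<close>.\<close>

lemma avg_variance:
  shows "integrable M (\<lambda>\<omega>. (avg f \<omega> - (LINT u|P. f u))\<^sup>2)"
    and "expectation (\<lambda>\<omega>. (avg f \<omega> - (LINT u|P. f u))\<^sup>2) \<le> B\<^sup>2 / n"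
proof -
  define \<mu> where "\<mu> = (LINT u|P. f u)"
  define Z where "Z i \<omega> = f (U i \<omega>) - \<mu>" for i \<omega>
  have mean: "expectation (\<lambda>\<omega>. f (U i \<omega>)) = \<mu>" if "i \<in> {1..n}" for i
    unfolding \<mu>_def by (rule U_expectation[OF that f])
  have [measurable]: "Z i \<in> borel_measurable M" if "i \<in> {1..n}" for i
    using that unfolding Z_def[abs_def] by measurable
  have sq: "integrable M (\<lambda>\<omega>. (f (U i \<omega>))\<^sup>2)" if "i \<in> {1..n}" for i
    by (rule integrable_const_bound[of _ "B\<^sup>2"])
       (use that in \<open>auto simp: f_sq_le\<close>)
  have Z_sq: "integrable M (\<lambda>\<omega>. (Z i \<omega>)\<^sup>2)" "expectation (\<lambda>\<omega>. (Z i \<omega>)\<^sup>2) \<le> B\<^sup>2"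
    if i: "i \<in> {1..n}" for i
  proof -
    have "(Z i \<omega>)\<^sup>2 = (f (U i \<omega>))\<^sup>2 - 2 * \<mu> * f (U i \<omega>) + \<mu>\<^sup>2" for \<omega>
      by (simp add: Z_def power2_diff)
    note Z2 = this
    show "integrable M (\<lambda>\<omega>. (Z i \<omega>)\<^sup>2)"
      unfolding Z2 using sq[OF i] f_U_integrable[OF i] by auto
    have "expectation (\<lambda>\<omega>. (Z i \<omega>)\<^sup>2) = expectation (\<lambda>\<omega>. (f (U i \<omega>))\<^sup>2) - \<mu>\<^sup>2"
      unfolding Z2 using sq[OF i] f_U_integrable[OF i]
      by (simp add: mean[OF i] prob_space power2_eq_square)
    also have "\<dots> \<le> expectation (\<lambda>\<omega>. (f (U i \<omega>))\<^sup>2)"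
      by simp
    also have "\<dots> \<le> expectation (\<lambda>\<omega>. B\<^sup>2)"
      by (intro integral_mono sq i f_sq_le) auto
    finally show "expectation (\<lambda>\<omega>. (Z i \<omega>)\<^sup>2) \<le> B\<^sup>2"
      by (simp add: prob_space)
  qed
  have orth: "expectation (\<lambda>\<omega>. Z i \<omega> * Z j \<omega>) = 0" if "i \<in> {1..n}" "j \<in> {1..n}" "i \<noteq> j" for i j
  proof -
    have "indep_vars (\<lambda>_. borel) Z {1..n}"
      unfolding Z_def[abs_def] by (rule indep_vars_compose2[OF U_indep]) simp
    then have "indep_vars (\<lambda>_. borel) Z (insert i {j})"
      by (rule indep_vars_subset) (use that in auto)
    \<comment> \<open>The rule for sums, taken over the singleton \<open>{j}\<close>, turns
      independence of the family into independence of the pair.\<close>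
    then have "indep_var borel (Z i) borel (Z j)"
      using indep_vars_sum[of "{j}" i Z] that by simp
    then have "expectation (\<lambda>\<omega>. Z i \<omega> * Z j \<omega>) = expectation (Z i) * expectation (Z j)"
      by (rule indep_var_lebesgue_integral)
         (use that f_U_integrable in \<open>auto simp: Z_def[abs_def]\<close>)
    moreover have "expectation (Z i) = 0"
      using that f_U_integrable by (simp add: Z_def[abs_def] mean prob_space)
    ultimately show ?thesis by simp
  qed
  have eq: "(avg f \<omega> - \<mu>)\<^sup>2 = (\<Sum>i=1..n. Z i \<omega>)\<^sup>2 / (real n)\<^sup>2" for \<omega>
    using n by (simp add: avg_def Z_def sum_subtractf power_divide[symmetric] diff_divide_distrib)
  note S = expectation_sq_sum_le[of "{1..n}" Z "B\<^sup>2", OF _ _ Z_sq orth]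
  show "integrable M (\<lambda>\<omega>. (avg f \<omega> - (LINT u|P. f u))\<^sup>2)"
    unfolding \<mu>_def[symmetric] eq using S(1) by auto
  show "expectation (\<lambda>\<omega>. (avg f \<omega> - (LINT u|P. f u))\<^sup>2) \<le> B\<^sup>2 / n"
    unfolding \<mu>_def[symmetric] eq using S(2) n
    by (simp add: divide_simps power2_eq_square mult_ac)
qed

text \<open>For distinct indices the expected product factors into a design part and a noise part;
  the latter vanishes because the errors are centred and independent of each other.\<close>

lemma avg_noise_variance:
  shows "integrable M (\<lambda>\<omega>. (avg_noise f k \<omega>)\<^sup>2)"
    and "expectation (\<lambda>\<omega>. (avg_noise f k \<omega>)\<^sup>2) \<le> B\<^sup>2 * \<sigma>2 / n"
proof -
  define Z where "Z i \<omega> = f (U i \<omega>) * e i \<omega> $ k" for i \<omega>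
  have [measurable]: "Z i \<in> borel_measurable M" if "i \<in> {1..n}" for i
    using that unfolding Z_def[abs_def] by measurable
  have le: "(Z i \<omega>)\<^sup>2 \<le> B\<^sup>2 * (e i \<omega> $ k)\<^sup>2" for i \<omega>
    unfolding Z_def power_mult_distrib by (intro mult_right_mono f_sq_le) auto
  have Z_sq: "integrable M (\<lambda>\<omega>. (Z i \<omega>)\<^sup>2)" "expectation (\<lambda>\<omega>. (Z i \<omega>)\<^sup>2) \<le> B\<^sup>2 * \<sigma>2"
    if i: "i \<in> {1..n}" for i
  proof -
    have int: "integrable M (\<lambda>\<omega>. B\<^sup>2 * (e i \<omega> $ k)\<^sup>2)"
      using noise_moments(3)[OF i] by auto
    show Z2: "integrable M (\<lambda>\<omega>. (Z i \<omega>)\<^sup>2)"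
      by (rule Bochner_Integration.integrable_bound[OF int]) (use i le in auto)
    have "expectation (\<lambda>\<omega>. (Z i \<omega>)\<^sup>2) \<le> expectation (\<lambda>\<omega>. B\<^sup>2 * (e i \<omega> $ k)\<^sup>2)"
      by (intro integral_mono Z2 int le)
    also have "\<dots> \<le> B\<^sup>2 * \<sigma>2"
      using noise_moments(4)[OF i, of k] by (simp add: mult_left_mono)
    finally show "expectation (\<lambda>\<omega>. (Z i \<omega>)\<^sup>2) \<le> B\<^sup>2 * \<sigma>2" .
  qed
  have orth: "expectation (\<lambda>\<omega>. Z i \<omega> * Z j \<omega>) = 0" if ij: "i \<in> {1..n}" "j \<in> {1..n}" "i \<noteq> j" for i j
  proof -
    have "indep_vars (\<lambda>_. borel) (\<lambda>i \<omega>. e i \<omega> $ k) {1..n}"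
      by (rule indep_vars_compose2[OF e_indep]) simp
    then have "indep_vars (\<lambda>_. borel) (\<lambda>i \<omega>. e i \<omega> $ k) (insert i {j})"
      by (rule indep_vars_subset) (use ij in auto)
    then have e_ij: "indep_var borel (\<lambda>\<omega>. e i \<omega> $ k) borel (\<lambda>\<omega>. e j \<omega> $ k)"
      using indep_vars_sum[of "{j}" i "\<lambda>i \<omega>. e i \<omega> $ k"] ij by simp
    note ee = indep_var_integrable[OF e_ij] indep_var_lebesgue_integral[OF e_ij]
    have "indep_var borel (\<lambda>\<omega>. (\<lambda>x. x i $ k * x j $ k) (\<lambda>i\<in>{1..n}. e i \<omega>))
        borel (\<lambda>\<omega>. (\<lambda>x. f (x i) * f (x j)) (\<lambda>i\<in>{1..n}. U i \<omega>))"
      by (rule indep_rv_indep_var_compose[OF joint_indep]) (use ij in measurable)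
    then have ind: "indep_var borel (\<lambda>\<omega>. e i \<omega> $ k * e j \<omega> $ k) borel (\<lambda>\<omega>. f (U i \<omega>) * f (U j \<omega>))"
      using ij by simp
    have "\<bar>f u * f v\<bar> \<le> B * B" for u v
      unfolding abs_mult by (intro mult_mono f_le bound_nonneg) auto
    then have ff: "integrable M (\<lambda>\<omega>. f (U i \<omega>) * f (U j \<omega>))"
      by (intro integrable_const_bound[of _ "B * B"]) (use ij in auto)
    have "expectation (\<lambda>\<omega>. Z i \<omega> * Z j \<omega>)
        = expectation (\<lambda>\<omega>. (e i \<omega> $ k * e j \<omega> $ k) * (f (U i \<omega>) * f (U j \<omega>)))"
      by (simp add: Z_def mult_ac)
    also have "\<dots> = expectation (\<lambda>\<omega>. e i \<omega> $ k * e j \<omega> $ k) * expectation (\<lambda>\<omega>. f (U i \<omega>) * f (U j \<omega>))"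
      using ij by (intro indep_var_lebesgue_integral[OF ind] ff ee noise_moments)
    also have "expectation (\<lambda>\<omega>. e i \<omega> $ k * e j \<omega> $ k) = 0"
      using ij ee(2) by (simp add: noise_moments)
    finally show ?thesis by simp
  qed
  have eq: "(avg_noise f k \<omega>)\<^sup>2 = (\<Sum>i=1..n. Z i \<omega>)\<^sup>2 / (real n)\<^sup>2" for \<omega>
    by (simp add: avg_noise_def Z_def power_divide)
  note S = expectation_sq_sum_le[of "{1..n}" Z "B\<^sup>2 * \<sigma>2", OF _ _ Z_sq orth]
  show "integrable M (\<lambda>\<omega>. (avg_noise f k \<omega>)\<^sup>2)"
    unfolding eq using S(1) by auto
  show "expectation (\<lambda>\<omega>. (avg_noise f k \<omega>)\<^sup>2) \<le> B\<^sup>2 * \<sigma>2 / n"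
    unfolding eq using S(2) n
    by (simp add: divide_simps power2_eq_square mult_ac)
qed

text \<open>Hoeffding's inequality for values in an interval of length \<open>2 * B\<close>, whose
  square produces the denominator of the exponent.\<close>

lemma avg_concentration:
  fixes \<eta> :: real
  assumes B: "0 < B" and \<eta>: "0 \<le> \<eta>"
  shows "prob {\<omega> \<in> space M. \<eta> \<le> \<bar>avg f \<omega> - (LINT u|P. f u)\<bar>} \<le> 2 * exp (- real n * \<eta>\<^sup>2 / (2 * B\<^sup>2))"
proof -
  have one: "1 \<in> {1..n}" using n by auto
  interpret H: Hoeffding_ineq_iid M "{1..n}" "\<lambda>i \<omega>. f (U i \<omega>)" "\<lambda>\<omega>. f (U 1 \<omega>)" "-B" B
    "expectation (\<lambda>\<omega>. f (U 1 \<omega>))"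
  proof unfold_locales
    show "indep_vars (\<lambda>_. borel) (\<lambda>i \<omega>. f (U i \<omega>)) {1..n}"
      by (rule indep_vars_compose2[OF U_indep]) simp
    show "distr M borel (\<lambda>\<omega>. f (U i \<omega>)) = distr M borel (\<lambda>\<omega>. f (U 1 \<omega>))" if "i \<in> {1..n}" for i
      using distr_distr[of f borel borel "U i" M] distr_distr[of f borel borel "U 1" M] that one
      by (simp add: U_distr o_def)
    show "AE \<omega> in M. f (U 1 \<omega>) \<in> {-B..B}"
      using f_le by (auto simp: abs_le_iff minus_le_iff)
    show "random_variable borel (\<lambda>\<omega>. f (U 1 \<omega>))"
      using one by measurable
  qed simp_all
  have card: "real (card {1..n}) = real n" by simp
  have expo: "-2 * real n * \<eta>\<^sup>2 / (B - - B)\<^sup>2 = - real n * \<eta>\<^sup>2 / (2 * B\<^sup>2)"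
    by (simp add: power2_eq_square)
  have "prob {\<omega> \<in> space M. \<eta> \<le> \<bar>(\<Sum>i=1..n. f (U i \<omega>)) / real (card {1..n}) - expectation (\<lambda>\<omega>. f (U 1 \<omega>))\<bar>}
      \<le> 2 * exp (-2 * real (card {1..n}) * \<eta>\<^sup>2 / (B - - B)\<^sup>2)"
    by (rule H.Hoeffding_ineq_abs_ge'[OF \<eta>]) (use B n in auto)
  then show ?thesis
    unfolding avg_def U_expectation[OF one f] card expo .
qed

end

end

subsection \<open>Mean square error of the slope\<close>

text \<open>\<open>w\<close> stands for the kernel weight and \<open>r\<close> for the Taylor
  remainder at a rescaled design point. \<open>R1\<close> will be of order h^2, while
  \<open>R2\<close>, the bound on \<open>r u - r (- u)\<close>, will be of order h^3. Taking
  \<open>\<rho> \<ge> 1\<close> lets one radius bound the constant coordinate of \<psi> as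
  well.\<close>

locale local_regression = regression_sample M n P U e \<epsilon>
  for M :: "'w measure" and n and P :: "(real ^ 'd) measure" and U
    and e :: "nat \<Rightarrow> 'w \<Rightarrow> real ^ 'l" and \<epsilon> +
  fixes w :: "real ^ 'd \<Rightarrow> real" and r :: "real ^ 'd \<Rightarrow> real ^ 'l" and W \<rho> R1 R2 \<kappa> :: real
  assumes P_sym: "distr P borel uminus = P"
    and w_measurable[measurable]: "w \<in> borel_measurable borel"
    and r_measurable[measurable]: "r \<in> borel_measurable borel"
    and w_even: "\<And>u. w (- u) = w u"
    and w_le: "\<And>u. \<bar>w u\<bar> \<le> W" and w_supp: "\<And>u. w u \<noteq> 0 \<Longrightarrow> norm u \<le> \<rho>"
    and W: "0 < W" and \<rho>: "1 \<le> \<rho>" and \<kappa>: "0 < \<kappa>"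
    and r_le: "\<And>u. norm (r u) \<le> R1" and r_odd_le: "\<And>u. norm (r u - r (- u)) \<le> R2"
    and moment: "\<And>x :: real ^ 'd option. \<kappa> * (norm x)\<^sup>2
      \<le> (\<Sum>p\<in>UNIV. \<Sum>q\<in>UNIV. x $ p * (LINT u|P. w u * \<psi> u $ p * \<psi> u $ q) * x $ q)"
begin

definition S :: "'d option \<Rightarrow> 'd option \<Rightarrow> real" where
  "S p q = (LINT u|P. w u * \<psi> u $ p * \<psi> u $ q)"

definition T :: "'d option \<Rightarrow> 'd option \<Rightarrow> 'w \<Rightarrow> real" where
  "T p q = avg (\<lambda>u. w u * \<psi> u $ p * \<psi> u $ q)"

definition bias :: "'l \<Rightarrow> 'd option \<Rightarrow> 'w \<Rightarrow> real" where
  "bias k p = avg (\<lambda>u. w u * \<psi> u $ p * r u $ k)"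

definition noise :: "'l \<Rightarrow> 'd option \<Rightarrow> 'w \<Rightarrow> real" where
  "noise k p = avg_noise (\<lambda>u. w u * \<psi> u $ p) k"

lemma \<psi>_measurable[measurable]: "(\<lambda>u :: real ^ 'd. \<psi> u $ p) \<in> borel_measurable borel"
  by (cases p) (simp_all add: \<psi>_nth)

lemma \<psi>_even: "\<psi> (- u :: real ^ 'd) $ p = (if p = None then 1 else -1) * \<psi> u $ p"
  by (cases p) (simp_all add: \<psi>_nth)

lemma P_integral_uminus:
  fixes f :: "real ^ 'd \<Rightarrow> real"
  assumes [measurable]: "f \<in> borel_measurable borel"
  shows "(LINT u|P. f (- u)) = (LINT u|P. f u)"
proof -
  have P: "sets P = sets borel"
    using U_distr[of 1] n by (metis atLeastAtMost_iff order_refl sets_distr)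
  have "(LINT u|distr P borel uminus. f u) = (LINT u|P. f (- u))"
    by (rule integral_distr) (auto simp: measurable_cong_sets[OF P refl])
  then show ?thesis by (simp add: P_sym)
qed

lemma P_prob_space: "prob_space P"
  using prob_space_distr[OF U_measurable, of 1] U_distr[of 1] n by simp

lemma P_integrable_bounded:
  fixes f :: "real ^ 'd \<Rightarrow> real"
  assumes [measurable]: "f \<in> borel_measurable borel" and "\<And>u. \<bar>f u\<bar> \<le> b"
  shows "integrable P f"
proof -
  have P: "sets P = sets borel"
    using U_distr[of 1] n by (metis atLeastAtMost_iff order_refl sets_distr)
  interpret P: prob_space P by (rule P_prob_space)
  show ?thesis
    by (rule P.integrable_const_bound[of _ b]) (auto simp: assms measurable_cong_sets[OF P refl])
qed

lemma weighted_\<psi>_le: "\<bar>w u * \<psi> u $ p\<bar> \<le> W * \<rho>"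
proof (cases "w u = 0")
  case False
  have "\<bar>\<psi> u $ p\<bar> \<le> \<rho>"
    using w_supp[OF False] \<rho> component_le_norm_cart[of u "the p"]
    by (cases p) (auto simp: \<psi>_nth)
  then show ?thesis
    unfolding abs_mult using w_le W by (intro mult_mono) auto
qed (use W \<rho> in simp)

lemma weighted_\<psi>\<psi>_le: "\<bar>w u * \<psi> u $ p * \<psi> u $ q\<bar> \<le> W * \<rho> * \<rho>"
proof (cases "w u = 0")
  case False
  have "\<bar>\<psi> u $ q\<bar> \<le> \<rho>"
    using w_supp[OF False] \<rho> component_le_norm_cart[of u "the q"]
    by (cases q) (auto simp: \<psi>_nth)
  then show ?thesis
    unfolding abs_mult[of "w u * _"] using weighted_\<psi>_le[of u p] W \<rho> by (intro mult_mono) auto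
qed (use W \<rho> in simp)

lemma weighted_remainder_le: "\<bar>w u * \<psi> u $ p * r u $ k\<bar> \<le> W * \<rho> * R1"
  unfolding abs_mult[of "w u * _"] using weighted_\<psi>_le[of u p] W \<rho>
    order_trans[OF component_le_norm_cart r_le]
  by (intro mult_mono) auto

text \<open>The integrand is odd under reflection, while the law \<open>P\<close> is
  symmetric.\<close>

lemma S_block: "S (Some j) None = 0"
proof -
  have "S (Some j) None = (LINT u|P. w (- u) * \<psi> (- u) $ Some j * \<psi> (- u) $ None)"
    unfolding S_def by (rule P_integral_uminus[symmetric]) measurable
  then show ?thesis by (simp add: S_def w_even \<psi>_even)
qed

text \<open>Symmetrization removes the part of the remainder of even order.\<close>

lemma bias_mean_le: "\<bar>LINT u|P. w u * \<psi> u $ Some j * r u $ k\<bar> \<le> W * \<rho> * R2 / 2"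
proof -
  define f where "f u = w u * \<psi> u $ Some j * r u $ k" for u
  have [measurable]: "f \<in> borel_measurable borel"
    unfolding f_def[abs_def] by measurable
  have f_le: "\<bar>f u\<bar> \<le> W * \<rho> * R1" for u
    unfolding f_def by (rule weighted_remainder_le)
  interpret P: prob_space P by (rule P_prob_space)
  have int: "integrable P f" "integrable P (\<lambda>u. f (- u))"
    by (rule P_integrable_bounded[of _ "W * \<rho> * R1"]; (rule f_le)?; measurable)+
  have sym_le: "\<bar>f u + f (- u)\<bar> \<le> W * \<rho> * R2" for u
  proof -
    have "f u + f (- u) = (w u * \<psi> u $ Some j) * (r u - r (- u)) $ k"
      by (simp add: f_def w_even \<psi>_even algebra_simps)
    also have "\<bar>\<dots>\<bar> \<le> (W * \<rho>) * R2"
      unfolding abs_mult[of "w u * _"] using weighted_\<psi>_le[of u "Some j"] W \<rho>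
        order_trans[OF component_le_norm_cart r_odd_le]
      by (intro mult_mono) auto
    finally show ?thesis .
  qed
  \<comment> \<open>Symmetry of \<open>P\<close> replaces the integrand by its symmetrization, which
    involves \<open>r\<close> through \<open>r u - r (- u)\<close> alone.\<close>
  have "2 * (LINT u|P. f u) = (LINT u|P. f u + f (- u))"
    using int P_integral_uminus[of f] by simp
  also have "\<bar>\<dots>\<bar> \<le> (LINT u|P. W * \<rho> * R2)"
    using int by (intro integral_abs_bound[THEN order_trans] integral_mono sym_le) auto
  finally show ?thesis by (simp add: f_def P.prob_space)
qed

text \<open>Splitting off the mean gives a variance term of size \<open>R1\<^sup>2 / n\<close> and a
  squared mean governed by the smaller bound \<open>R2\<close>.\<close>

lemma bias_second_moment:
  shows "integrable M (\<lambda>\<omega>. (bias k (Some j) \<omega>)\<^sup>2)"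
    and "expectation (\<lambda>\<omega>. (bias k (Some j) \<omega>)\<^sup>2) \<le> 2 * (W * \<rho> * R1)\<^sup>2 / n + (W * \<rho> * R2)\<^sup>2 / 2"
proof -
  define \<mu> where "\<mu> = (LINT u|P. w u * \<psi> u $ Some j * r u $ k)"
  have m: "(\<lambda>u. w u * \<psi> u $ Some j * r u $ k) \<in> borel_measurable borel"
    by measurable
  note var = avg_variance[OF m weighted_remainder_le, folded bias_def \<mu>_def]
  have [measurable]: "bias k (Some j) \<in> borel_measurable M"
    unfolding bias_def by (rule avg_measurable[OF m weighted_remainder_le])
  have le: "(bias k (Some j) \<omega>)\<^sup>2 \<le> 2 * (bias k (Some j) \<omega> - \<mu>)\<^sup>2 + 2 * \<mu>\<^sup>2" for \<omega>
  proof -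
    have "0 \<le> (bias k (Some j) \<omega> - 2 * \<mu>)\<^sup>2" by simp
    then show ?thesis by (simp add: power2_diff power_mult_distrib algebra_simps)
  qed
  have int: "integrable M (\<lambda>\<omega>. 2 * (bias k (Some j) \<omega> - \<mu>)\<^sup>2 + 2 * \<mu>\<^sup>2)"
    using var(1) by auto
  show bi: "integrable M (\<lambda>\<omega>. (bias k (Some j) \<omega>)\<^sup>2)"
    by (rule Bochner_Integration.integrable_bound[OF int]) (use le in auto)
  have "\<bar>\<mu>\<bar>\<^sup>2 \<le> (W * \<rho> * R2 / 2)\<^sup>2"
    unfolding \<mu>_def by (intro power_mono bias_mean_le) simp
  then have \<mu>: "2 * \<mu>\<^sup>2 \<le> (W * \<rho> * R2)\<^sup>2 / 2"
    by (simp add: power_divide)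
  have "expectation (\<lambda>\<omega>. (bias k (Some j) \<omega>)\<^sup>2)
      \<le> expectation (\<lambda>\<omega>. 2 * (bias k (Some j) \<omega> - \<mu>)\<^sup>2 + 2 * \<mu>\<^sup>2)"
    by (intro integral_mono bi int le)
  also have "\<dots> = 2 * expectation (\<lambda>\<omega>. (bias k (Some j) \<omega> - \<mu>)\<^sup>2) + 2 * \<mu>\<^sup>2"
    using var(1) by (simp add: prob_space)
  also have "\<dots> \<le> 2 * (W * \<rho> * R1)\<^sup>2 / n + (W * \<rho> * R2)\<^sup>2 / 2"
    using var(2) \<mu> by simp
  finally show "expectation (\<lambda>\<omega>. (bias k (Some j) \<omega>)\<^sup>2)
    \<le> 2 * (W * \<rho> * R1)\<^sup>2 / n + (W * \<rho> * R2)\<^sup>2 / 2" .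
qed

lemma bias_le: "\<bar>bias k p \<omega>\<bar> \<le> W * \<rho> * R1"
proof -
  have "\<bar>\<Sum>i=1..n. w (U i \<omega>) * \<psi> (U i \<omega>) $ p * r (U i \<omega>) $ k\<bar> \<le> (\<Sum>i=1..n. W * \<rho> * R1)"
    by (intro order_trans[OF sum_abs] sum_mono weighted_remainder_le)
  then show ?thesis
    using n by (simp add: bias_def avg_def divide_le_eq mult.commute)
qed

text \<open>The entrywise threshold: if all \<open>(d + 1)^2\<close> entries deviate by less than
  this, the Frobenius distance is at most \<open>\<kappa> / 2\<close>.\<close>

definition \<eta> :: real where "\<eta> = \<kappa> / (2 * real CARD('d option))"

text \<open>Formed entry by entry, so that Hoeffding's inequality and a union bound control its
  probability.\<close>

definition bad :: "'w set" where
  "bad = (\<Union>p\<in>UNIV. \<Union>q\<in>UNIV. {\<omega> \<in> space M. \<eta> \<le> \<bar>T p q \<omega> - S p q\<bar>})"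

lemma moment_function_measurable: "(\<lambda>u :: real ^ 'd. w u * \<psi> u $ p * \<psi> u $ q) \<in> borel_measurable borel"
  by measurable

lemma T_measurable[measurable]: "T p q \<in> borel_measurable M"
  unfolding T_def by (rule avg_measurable[OF moment_function_measurable weighted_\<psi>\<psi>_le])

lemma bad_sets[measurable]: "bad \<in> events"
  unfolding bad_def by measurable

lemma \<eta>_pos: "0 < \<eta>"
  using \<kappa> by (simp add: \<eta>_def)

lemma prob_bad_le:
  "prob bad \<le> (real CARD('d option))\<^sup>2 * (2 * exp (- real n * \<eta>\<^sup>2 / (2 * (W * \<rho> * \<rho>)\<^sup>2)))"
proof -
  have one: "prob {\<omega> \<in> space M. \<eta> \<le> \<bar>T p q \<omega> - S p q\<bar>}
      \<le> 2 * exp (- real n * \<eta>\<^sup>2 / (2 * (W * \<rho> * \<rho>)\<^sup>2))" for p q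
    unfolding T_def S_def
    by (rule avg_concentration[OF moment_function_measurable weighted_\<psi>\<psi>_le])
       (use \<eta>_pos W \<rho> in auto)
  have "prob bad \<le> (\<Sum>p\<in>UNIV. prob (\<Union>q\<in>UNIV. {\<omega> \<in> space M. \<eta> \<le> \<bar>T p q \<omega> - S p q\<bar>}))"
    unfolding bad_def by (rule measure_UNION_le) auto
  also have "\<dots> \<le> (\<Sum>p\<in>UNIV. \<Sum>q\<in>UNIV. prob {\<omega> \<in> space M. \<eta> \<le> \<bar>T p q \<omega> - S p q\<bar>})"
    by (intro sum_mono measure_UNION_le) auto
  also have "\<dots> \<le> (\<Sum>p\<in>(UNIV :: 'd option set). \<Sum>q\<in>(UNIV :: 'd option set).
      2 * exp (- real n * \<eta>\<^sup>2 / (2 * (W * \<rho> * \<rho>)\<^sup>2)))"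
    by (intro sum_mono one)
  finally show ?thesis by (simp add: power2_eq_square)
qed

definition deviation :: "'w \<Rightarrow> real" where
  "deviation \<omega> = (\<Sum>p\<in>UNIV. \<Sum>q\<in>UNIV. (T p q \<omega> - S p q)\<^sup>2)"

lemma deviation_moment:
  shows "integrable M deviation"
    and "expectation deviation \<le> (real CARD('d option))\<^sup>2 * ((W * \<rho> * \<rho>)\<^sup>2 / n)"
proof -
  note var = avg_variance[OF moment_function_measurable weighted_\<psi>\<psi>_le, folded T_def S_def]
  show "integrable M deviation"
    unfolding deviation_def[abs_def] by (intro Bochner_Integration.integrable_sum var(1))
  have "expectation deviation = (\<Sum>p\<in>UNIV. \<Sum>q\<in>UNIV. expectation (\<lambda>\<omega>. (T p q \<omega> - S p q)\<^sup>2))"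
    unfolding deviation_def[abs_def] using var(1) by (simp add: Bochner_Integration.integral_sum)
  also have "\<dots> \<le> (\<Sum>p\<in>(UNIV :: 'd option set). \<Sum>q\<in>(UNIV :: 'd option set). (W * \<rho> * \<rho>)\<^sup>2 / n)"
    by (intro sum_mono var(2))
  finally show "expectation deviation \<le> (real CARD('d option))\<^sup>2 * ((W * \<rho> * \<rho>)\<^sup>2 / n)"
    by (simp add: power2_eq_square mult.assoc)
qed

lemma deviation_le:
  assumes "\<omega> \<in> space M" "\<omega> \<notin> bad"
  shows "deviation \<omega> \<le> (\<kappa> / 2)\<^sup>2"
proof -
  have "(T p q \<omega> - S p q)\<^sup>2 \<le> \<eta>\<^sup>2" for p q
  proof -
    have "\<not> \<eta> \<le> \<bar>T p q \<omega> - S p q\<bar>"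
      using assms unfolding bad_def by blast
    then show ?thesis by (intro abs_le_square_iff[THEN iffD1]) simp
  qed
  then have "deviation \<omega> \<le> (\<Sum>p\<in>(UNIV :: 'd option set). \<Sum>q\<in>(UNIV :: 'd option set). \<eta>\<^sup>2)"
    unfolding deviation_def by (intro sum_mono)
  also have "\<dots> = (real CARD('d option) * \<eta>)\<^sup>2"
    by (simp add: power2_eq_square mult_ac)
  also have "real CARD('d option) * \<eta> = \<kappa> / 2"
    unfolding \<eta>_def using zero_less_card_finite[where 'a = "'d option"]
    by (simp del: card_UNIV_option add: field_simps)
  finally show ?thesis .
qed

text \<open>A majorant of the squared rescaled slope error outside \<open>bad\<close>, linear in
  quantities with known expectations. All noise coordinates occur, since the intercept noise feeds
  back through the deviation.\<close>

definition error_bound :: "'l \<Rightarrow> 'w \<Rightarrow> real" where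
  "error_bound k \<omega> = 4 * (\<Sum>j\<in>UNIV. (bias k (Some j) \<omega>)\<^sup>2) + 8 * (\<Sum>p\<in>UNIV. (noise k p \<omega>)\<^sup>2)
    + 16 * real CARD('d option) * (W * \<rho> * R1)\<^sup>2 / \<kappa>\<^sup>2 * deviation \<omega>"

definition error_const :: real where
  "error_const = 4 * real CARD('d) * (2 * (W * \<rho> * R1)\<^sup>2 / n + (W * \<rho> * R2)\<^sup>2 / 2)
    + 8 * real CARD('d option) * ((W * \<rho>)\<^sup>2 * \<sigma>2 / n)
    + 16 * real CARD('d option) * (W * \<rho> * R1)\<^sup>2 / \<kappa>\<^sup>2
      * ((real CARD('d option))\<^sup>2 * ((W * \<rho> * \<rho>)\<^sup>2 / n))"

lemma error_bound_moment:
  shows "integrable M (error_bound k)" and "expectation (error_bound k) \<le> error_const"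
proof -
  have m: "(\<lambda>u :: real ^ 'd. w u * \<psi> u $ p) \<in> borel_measurable borel" for p
    by measurable
  note nv = avg_noise_variance[OF m weighted_\<psi>_le, folded noise_def]
  note int = nv(1) bias_second_moment(1) deviation_moment(1)
  show "integrable M (error_bound k)"
    unfolding error_bound_def[abs_def] using int by auto
  have "expectation (error_bound k) = 4 * (\<Sum>j\<in>UNIV. expectation (\<lambda>\<omega>. (bias k (Some j) \<omega>)\<^sup>2))
      + 8 * (\<Sum>p\<in>UNIV. expectation (\<lambda>\<omega>. (noise k p \<omega>)\<^sup>2))
      + 16 * real CARD('d option) * (W * \<rho> * R1)\<^sup>2 / \<kappa>\<^sup>2 * expectation deviation"
    unfolding error_bound_def[abs_def] using int by (simp add: Bochner_Integration.integral_sum)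
  also have "\<dots> \<le> 4 * (\<Sum>j\<in>(UNIV :: 'd set). 2 * (W * \<rho> * R1)\<^sup>2 / n + (W * \<rho> * R2)\<^sup>2 / 2)
      + 8 * (\<Sum>p\<in>(UNIV :: 'd option set). (W * \<rho>)\<^sup>2 * \<sigma>2 / n)
      + 16 * real CARD('d option) * (W * \<rho> * R1)\<^sup>2 / \<kappa>\<^sup>2
        * ((real CARD('d option))\<^sup>2 * ((W * \<rho> * \<rho>)\<^sup>2 / n))"
    by (intro add_mono mult_left_mono sum_mono bias_second_moment(2) nv(2) deviation_moment(2)) auto
  also have "\<dots> = error_const"
    by (simp add: error_const_def)
  finally show "expectation (error_bound k) \<le> error_const" .
qed

lemma slope_error_le_error_bound:
  assumes \<omega>: "\<omega> \<in> space M" "\<omega> \<notin> bad"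
    and eq: "\<And>p. (\<Sum>q\<in>UNIV. T p q \<omega> * v $ q) = bias k p \<omega> + noise k p \<omega>"
  shows "\<kappa>\<^sup>2 * (\<Sum>j\<in>UNIV. (v $ Some j)\<^sup>2) \<le> error_bound k \<omega>"
proof -
  define s where "s = (\<chi> p. bias k p \<omega> + noise k p \<omega>)"
  define b where "b = (W * \<rho> * R1)\<^sup>2"
  define N where "N = (\<Sum>p\<in>UNIV. (noise k p \<omega>)\<^sup>2)"
  have sq: "(x + y)\<^sup>2 \<le> 2 * x\<^sup>2 + 2 * y\<^sup>2" for x y :: real
    using zero_le_power2[of "x - y"] by (simp add: power2_diff power2_sum del: zero_le_power2)
  have dev: "deviation \<omega> \<le> (\<kappa> / 2)\<^sup>2" "0 \<le> deviation \<omega>"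
    by (rule deviation_le[OF \<omega>]) (simp add: deviation_def sum_nonneg)
  have s_norm: "(norm s)\<^sup>2 \<le> 2 * (CARD('d option) * b) + 2 * N"
  proof -
    have "(norm s)\<^sup>2 \<le> (\<Sum>p\<in>(UNIV :: 'd option set). 2 * b + 2 * (noise k p \<omega>)\<^sup>2)"
      unfolding norm_sq_vec s_def vec_lambda_beta
    proof (rule sum_mono)
      fix p
      have "(bias k p \<omega>)\<^sup>2 \<le> b"
        unfolding b_def using bias_le[of k p \<omega>] by (simp add: abs_le_square_iff[symmetric])
      then show "(bias k p \<omega> + noise k p \<omega>)\<^sup>2 \<le> 2 * b + 2 * (noise k p \<omega>)\<^sup>2"
        using sq[of "bias k p \<omega>" "noise k p \<omega>"] by linarith
    qed
    then show ?thesis by (simp add: sum.distrib sum_distrib_left N_def)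
  qed
  have s_slope: "(\<Sum>j\<in>UNIV. (s $ Some j)\<^sup>2) \<le> 2 * (\<Sum>j\<in>UNIV. (bias k (Some j) \<omega>)\<^sup>2) + 2 * N"
  proof -
    have "(\<Sum>j\<in>UNIV. (s $ Some j)\<^sup>2)
        \<le> (\<Sum>j\<in>UNIV. 2 * (bias k (Some j) \<omega>)\<^sup>2 + 2 * (noise k (Some j) \<omega>)\<^sup>2)"
      unfolding s_def vec_lambda_beta by (intro sum_mono sq)
    also have "\<dots> \<le> 2 * (\<Sum>j\<in>UNIV. (bias k (Some j) \<omega>)\<^sup>2) + 2 * N"
      by (simp add: sum.distrib sum_distrib_left N_def sum_option)
    finally show ?thesis .
  qed
  have "\<kappa>\<^sup>2 * (\<Sum>j\<in>UNIV. (v $ Some j)\<^sup>2)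
      \<le> 2 * (\<Sum>j\<in>UNIV. (s $ Some j)\<^sup>2) + 8 / \<kappa>\<^sup>2 * deviation \<omega> * (norm s)\<^sup>2"
    unfolding deviation_def
    by (rule slope_error_bound[OF _ \<kappa> moment[folded S_def] S_block])
       (use eq dev(1) in \<open>auto simp: s_def deviation_def\<close>)
  also have "\<dots> \<le> 2 * (2 * (\<Sum>j\<in>UNIV. (bias k (Some j) \<omega>)\<^sup>2) + 2 * N)
      + 8 / \<kappa>\<^sup>2 * deviation \<omega> * (2 * (CARD('d option) * b) + 2 * N)"
    using dev \<kappa> by (intro add_mono mult_left_mono s_norm s_slope) auto
  \<comment> \<open>The product of \<open>deviation\<close> and \<open>norm s\<close> squared is
    decoupled: the bias part has a deterministic bound and keeps the deviation, whereas in the noise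
    part the deviation is replaced by its bound \<open>(\<kappa> / 2)\<^sup>2\<close>.\<close>
  also have "8 / \<kappa>\<^sup>2 * deviation \<omega> * (2 * (CARD('d option) * b) + 2 * N)
      \<le> 16 * real CARD('d option) * b / \<kappa>\<^sup>2 * deviation \<omega> + 4 * N"
  proof -
    have "0 \<le> N" by (simp add: N_def sum_nonneg)
    then have "16 / \<kappa>\<^sup>2 * N * deviation \<omega> \<le> 16 / \<kappa>\<^sup>2 * N * (\<kappa> / 2)\<^sup>2"
      by (intro mult_left_mono dev) auto
    also have "\<dots> = 4 * N"
      using \<kappa> by (simp add: power_divide)
    finally show ?thesis by (simp add: algebra_simps)
  qed
  finally show ?thesis
    by (simp add: error_bound_def b_def N_def)
qed

theorem truncated_slope_mse:
  assumes h: "0 < h" and J: "op_norm J \<le> L"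
    and eq: "AE \<omega> in M. \<forall>k p. (\<Sum>q\<in>UNIV. T p q \<omega> * error_row h (\<beta> \<omega>) (G \<omega> - J) k $ q)
      = bias k p \<omega> + noise k p \<omega>"
  shows "(\<integral>\<^sup>+ \<omega>. ennreal ((op_norm (truncate L (G \<omega>) - J))\<^sup>2) \<partial>M)
    \<le> ennreal (4 / (\<kappa>\<^sup>2 * h\<^sup>2) * (CARD('l) * error_const)
      + (2 * L)\<^sup>2 * ((real CARD('d option))\<^sup>2 * (2 * exp (- real n * \<eta>\<^sup>2 / (2 * (W * \<rho> * \<rho>)\<^sup>2)))))"
proof -
  have L: "0 \<le> L" using J op_norm_nonneg[of J] by linarith
  \<comment> \<open>An integrable majorant: the first summand serves outside \<open>bad\<close>,
    with 4 from the truncation factor 2 and \<open>h\<^sup>2\<close> from undoing the rescaling; on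
    \<open>bad\<close> truncation and the bound on \<open>J\<close> give
    \<open>2 * L\<close>.\<close>
  define F where "F \<omega> = 4 / (\<kappa>\<^sup>2 * h\<^sup>2) * (\<Sum>k\<in>UNIV. error_bound k \<omega>) + (2 * L)\<^sup>2 * indicator bad \<omega>" for \<omega>
  have eb_nonneg: "0 \<le> error_bound k \<omega>" for k \<omega>
    by (auto simp: error_bound_def deviation_def intro!: add_nonneg_nonneg sum_nonneg mult_nonneg_nonneg divide_nonneg_nonneg)
  have F_nonneg: "0 \<le> F \<omega>" for \<omega>
    unfolding F_def by (intro add_nonneg_nonneg mult_nonneg_nonneg sum_nonneg eb_nonneg) auto
  have int: "integrable M (\<lambda>\<omega>. 4 / (\<kappa>\<^sup>2 * h\<^sup>2) * (\<Sum>k\<in>UNIV. error_bound k \<omega>))"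
      "integrable M (\<lambda>\<omega>. (2 * L)\<^sup>2 * indicator bad \<omega> :: real)"
    by (intro integrable_mult_right Bochner_Integration.integrable_sum error_bound_moment(1)
        integrable_real_indicator; simp add: emeasure_eq_measure)+
  then have F_int: "integrable M F"
    unfolding F_def[abs_def] by (rule Bochner_Integration.integrable_add)
  have "AE \<omega> in M. (op_norm (truncate L (G \<omega>) - J))\<^sup>2 \<le> F \<omega>"
    using eq AE_space
  proof eventually_elim
    case (elim \<omega>)
    show ?case
    proof (cases "\<omega> \<in> bad")
      case True
      have "op_norm (truncate L (G \<omega>) - J) \<le> 2 * L"
        using op_norm_add[of "truncate L (G \<omega>)" "- J"] op_norm_truncate[OF L, of "G \<omega>"] J
        by (simp add: op_norm_minus)
      then have "(op_norm (truncate L (G \<omega>) - J))\<^sup>2 \<le> (2 * L)\<^sup>2"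
        by (intro power_mono op_norm_nonneg)
      also have "\<dots> \<le> F \<omega>"
        using True eb_nonneg by (auto simp: F_def intro!: mult_nonneg_nonneg sum_nonneg divide_nonneg_nonneg)
      finally show ?thesis .
    next
      case False
      have row: "\<kappa>\<^sup>2 * h\<^sup>2 * (\<Sum>j\<in>UNIV. ((G \<omega> - J) $ k $ j)\<^sup>2) \<le> error_bound k \<omega>" for k
        using slope_error_le_error_bound[OF elim(2) False, of "error_row h (\<beta> \<omega>) (G \<omega> - J) k" k] elim(1)
        by (simp add: error_row_def power_mult_distrib sum_distrib_left mult.assoc)
      have "(op_norm (truncate L (G \<omega>) - J))\<^sup>2 \<le> (2 * op_norm (G \<omega> - J))\<^sup>2"
        by (intro power_mono truncate_error_le J op_norm_nonneg)
      also have "\<dots> \<le> 4 * (\<Sum>k\<in>UNIV. \<Sum>j\<in>UNIV. ((G \<omega> - J) $ k $ j)\<^sup>2)"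
        using op_norm_sq_le_entries[of "G \<omega> - J"] by (simp add: power_mult_distrib)
      also have "\<dots> \<le> 4 * (\<Sum>k\<in>UNIV. error_bound k \<omega> / (\<kappa>\<^sup>2 * h\<^sup>2))"
        using row h \<kappa> by (intro mult_left_mono sum_mono) (auto simp: pos_le_divide_eq mult_ac)
      also have "\<dots> = F \<omega>"
        using False by (simp add: F_def sum_divide_distrib[symmetric])
      finally show ?thesis .
    qed
  qed
  then have "(\<integral>\<^sup>+ \<omega>. ennreal ((op_norm (truncate L (G \<omega>) - J))\<^sup>2) \<partial>M) \<le> (\<integral>\<^sup>+ \<omega>. ennreal (F \<omega>) \<partial>M)"
    by (intro nn_integral_mono_AE) (auto elim!: eventually_mono intro: ennreal_leI)
  also have "\<dots> = ennreal (expectation F)"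
    by (rule nn_integral_eq_integral[OF F_int]) (simp add: F_nonneg)
  also have "expectation F = 4 / (\<kappa>\<^sup>2 * h\<^sup>2) * (\<Sum>k\<in>UNIV. expectation (error_bound k)) + (2 * L)\<^sup>2 * prob bad"
    unfolding F_def[abs_def] using int error_bound_moment(1)
    by (subst Bochner_Integration.integral_add) (simp_all add: Bochner_Integration.integral_sum)
  also have "\<dots> \<le> 4 / (\<kappa>\<^sup>2 * h\<^sup>2) * (\<Sum>k\<in>(UNIV :: 'l set). error_const)
      + (2 * L)\<^sup>2 * ((real CARD('d option))\<^sup>2 * (2 * exp (- real n * \<eta>\<^sup>2 / (2 * (W * \<rho> * \<rho>)\<^sup>2))))"
    by (intro add_mono mult_left_mono sum_mono error_bound_moment(2) prob_bad_le) auto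
  finally show ?thesis by (simp add: ennreal_leI)
qed

end

section \<open>From the concrete hypotheses to the abstract regression setting\<close>

lemma indep_rv_cong:
  assumes "\<And>\<omega>. \<omega> \<in> space M \<Longrightarrow> Y \<omega> = Y' \<omega>"
  shows "indep_rv M S X T Y \<longleftrightarrow> indep_rv M S X T Y'"
proof -
  have "Y -` B \<inter> space M = Y' -` B \<inter> space M" for B
    using assms by auto
  then show ?thesis
    using measurable_cong[of M Y Y' T] assms unfolding indep_rv_def by simp
qed

lemma supp_uminus:
  fixes g :: "'a::euclidean_space \<Rightarrow> real"
  assumes "\<And>u. g (- u) = g u" "u \<in> supp g"
  shows "- u \<in> supp g"
proof -
  have "uminus ` {u. g u \<noteq> 0} = {u. g u \<noteq> 0}"
    by (auto simp: image_iff assms(1)) (metis assms(1) minus_minus)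
  then have "closure {u. g u \<noteq> 0} = uminus ` closure {u. g u \<noteq> 0}"
    using closure_scaleR[of "-1" "{u. g u \<noteq> 0}"] by simp
  then show ?thesis using assms(2) unfolding supp_def by force
qed

lemma nonzero_in_supp: "g u \<noteq> 0 \<Longrightarrow> u \<in> supp g"
  unfolding supp_def by (rule closure_subset[THEN subsetD]) simp

text \<open>A nonnegative constant is wanted so that the bounds are monotone in the size of the
  displacement.\<close>

lemma deriv_bounded_onE:
  assumes "deriv_bounded_on k S f"
  obtains B where "0 \<le> B"
    and "\<And>x vs. x \<in> S \<Longrightarrow> length vs = k \<Longrightarrow> norm (iter_deriv f vs x) \<le> B * prod_list (map norm vs)"
proof -
  obtain B where B: "\<And>x vs. x \<in> S \<Longrightarrow> length vs = k \<Longrightarrow>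
      norm (iter_deriv f vs x) \<le> B * prod_list (map norm vs)"
    using assms unfolding deriv_bounded_on_def by blast
  have "norm (iter_deriv f vs x) \<le> \<bar>B\<bar> * prod_list (map norm vs)" if "x \<in> S" "length vs = k" for x vs
  proof -
    have "0 \<le> prod_list (map norm vs)"
      by (rule prod_list_nonneg) auto
    then show ?thesis
      by (rule order_trans[OF B[OF that] mult_right_mono[OF abs_ge_self]])
  qed
  then show thesis using that[of "\<bar>B\<bar>"] by simp
qed

lemma quadratic_form_ge:
  fixes A :: "real ^ 'n ^ 'n"
  assumes "loewner_ge A (\<kappa> *\<^sub>R mat 1)"
  shows "\<kappa> * (norm x)\<^sup>2 \<le> (\<Sum>p\<in>UNIV. \<Sum>q\<in>UNIV. x $ p * A $ p $ q * x $ q)"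
proof -
  have "0 \<le> x \<bullet> ((A - \<kappa> *\<^sub>R mat 1) *v x)"
    using assms by (simp add: loewner_ge_def)
  also have "\<dots> = x \<bullet> (A *v x) - \<kappa> * (x \<bullet> x)"
    by (simp add: matrix_vector_mult_diff_rdistrib scaleR_matrix_vector_assoc[symmetric] inner_diff_right)
  also have "x \<bullet> (A *v x) = (\<Sum>p\<in>UNIV. \<Sum>q\<in>UNIV. x $ p * A $ p $ q * x $ q)"
    by (simp add: inner_vec_def matrix_vector_mult_def sum_distrib_left mult.assoc)
  finally show ?thesis by (simp add: power2_norm_eq_inner)
qed

text \<open>The kernel itself need not be measurable. Nondegeneracy of the moment matrix rules out the
  junk value \<open>0\<close> of a non-convergent integral, hence \<open>K g\<close> is measurable on the support.\<close>

lemma weight_moments: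
  fixes g K :: "real ^ 'd \<Rightarrow> real"
  assumes g: "\<And>u. 0 \<le> g u" "g \<in> borel_measurable borel" and \<kappa>: "0 < \<kappa>"
    and moment: "loewner_ge (LINT u:supp g|lborel. (K u * g u) *\<^sub>R outer (\<psi> u)) (\<kappa> *\<^sub>R mat 1)"
  defines "w \<equiv> \<lambda>u. if g u = 0 then 0 else K u"
  shows "w \<in> borel_measurable borel"
    and "\<kappa> * (norm x)\<^sup>2 \<le> (\<Sum>p\<in>UNIV. \<Sum>q\<in>UNIV.
      x $ p * (LINT u|density lborel (\<lambda>u. ennreal (g u)). w u * \<psi> u $ p * \<psi> u $ q) * x $ q)"
proof -
  define F where "F u = indicator (supp g) u *\<^sub>R ((K u * g u) *\<^sub>R outer (\<psi> u))" for u
  define A where "A = integral\<^sup>L lborel F"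
  have ge: "loewner_ge A (\<kappa> *\<^sub>R mat 1)"
    using moment unfolding A_def F_def set_lebesgue_integral_def .
  have F: "integrable lborel F"
  proof (rule ccontr)
    assume "\<not> integrable lborel F"
    \<comment> \<open>Testing a zero matrix against the unit vector of the intercept would force
      \<open>\<kappa> \<le> 0\<close>.\<close>
    then have "A = 0" unfolding A_def by (rule not_integrable_integral_eq)
    with quadratic_form_ge[OF ge, of "axis None 1"] \<kappa> show False by simp
  qed
  have F_nth: "F u $ p $ q = g u * (w u * \<psi> u $ p * \<psi> u $ q)" for u p q
    using nonzero_in_supp[of g u] by (auto simp: F_def w_def outer_def indicator_def)
  have F_comp: "integrable lborel (\<lambda>u. F u $ p $ q)" "A $ p $ q = (LINT u|lborel. F u $ p $ q)" for p q
    using integrable_bounded_linear[OF bounded_linear_compose[OF bounded_linear_vec_nth bounded_linear_vec_nth] F]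
      integral_bounded_linear[OF bounded_linear_compose[OF bounded_linear_vec_nth bounded_linear_vec_nth] F]
    by (simp_all add: A_def)
  have [measurable]: "(\<lambda>u. F u $ None $ None) \<in> borel_measurable borel"
    using borel_measurable_integrable[OF F_comp(1)] by simp
  \<comment> \<open>The intercept entry of the outer product is 1, so division by \<open>g\<close>
    recovers the weight; where \<open>g u = 0\<close>, division by zero gives 0, in agreement with
    the definition of \<open>w\<close>.\<close>
  have "w = (\<lambda>u. F u $ None $ None / g u)"
    by (auto simp: F_nth fun_eq_iff \<psi>_nth w_def)
  then show w[measurable]: "w \<in> borel_measurable borel"
    using g(2) by simp
  have [measurable]: "(\<lambda>u :: real ^ 'd. \<psi> u $ p) \<in> borel_measurable borel" for p
    by (cases p) (simp_all add: \<psi>_nth)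
  have "A $ p $ q = (LINT u|density lborel (\<lambda>u. ennreal (g u)). w u * \<psi> u $ p * \<psi> u $ q)" for p q
    unfolding F_comp(2) F_nth using g by (subst integral_density) auto
  then show "\<kappa> * (norm x)\<^sup>2 \<le> (\<Sum>p\<in>UNIV. \<Sum>q\<in>UNIV.
      x $ p * (LINT u|density lborel (\<lambda>u. ennreal (g u)). w u * \<psi> u $ p * \<psi> u $ q) * x $ q)"
    using quadratic_form_ge[OF ge, of x] by simp
qed

text \<open>Division by h^2 turns the squared odd remainder into order h^4 and the noise variance
  into 1/(n h^2). Terms with \<open>R1\<^sup>2 / n\<close> become h^4 times 1/(n h^2), where h^4 is
  replaced by the constant \<open>H ^ 4\<close>.\<close>

lemma (in local_regression) scaled_error_const_le:
  fixes h H a b :: real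
  assumes h: "0 < h" "h \<le> H" and R: "R1 = a * h\<^sup>2" "R2 = b * h ^ 3"
  shows "4 / (\<kappa>\<^sup>2 * h\<^sup>2) * (CARD('l) * error_const)
    \<le> 4 * real CARD('l) / \<kappa>\<^sup>2 * (2 * real CARD('d) * (W * \<rho> * b)\<^sup>2
        + (8 * real CARD('d) * (W * \<rho> * a)\<^sup>2
          + 16 * real CARD('d option) * (W * \<rho> * a)\<^sup>2 / \<kappa>\<^sup>2 * (real CARD('d option))\<^sup>2 * (W * \<rho> * \<rho>)\<^sup>2) * H ^ 4
        + 8 * real CARD('d option) * (W * \<rho>)\<^sup>2 * \<sigma>2) * (h ^ 4 + 1 / (n * h\<^sup>2))"
proof -
  define d N l where "d = real CARD('d)" and "N = real CARD('d option)" and "l = real CARD('l)"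
  define \<beta> where "\<beta> = 2 * d * (W * \<rho> * b)\<^sup>2"
  define \<alpha> where "\<alpha> = 8 * d * (W * \<rho> * a)\<^sup>2 + 16 * N * (W * \<rho> * a)\<^sup>2 / \<kappa>\<^sup>2 * N\<^sup>2 * (W * \<rho> * \<rho>)\<^sup>2"
  define \<gamma> where "\<gamma> = 8 * N * (W * \<rho>)\<^sup>2 * \<sigma>2"
  define m where "m = 1 / (n * h\<^sup>2)"
  have pos: "0 \<le> \<alpha>" "0 \<le> \<beta>" "0 \<le> \<gamma>" "0 \<le> m"
    using \<sigma>2_nonneg by (auto simp: \<alpha>_def \<beta>_def \<gamma>_def m_def d_def N_def)
  have "error_const = h\<^sup>2 * (\<beta> * h ^ 4 + \<alpha> * (h ^ 4 * m) + \<gamma> * m)"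
  proof -
    have n: "x / real n = x * (h\<^sup>2 * m)" for x
      using h n by (simp add: m_def)
    have sq: "(W * \<rho> * (a * h\<^sup>2))\<^sup>2 = (W * \<rho> * a)\<^sup>2 * h ^ 4" "(W * \<rho> * (b * h ^ 3))\<^sup>2 = (W * \<rho> * b)\<^sup>2 * (h\<^sup>2 * h ^ 4)"
      by (simp_all add: power_mult_distrib power_mult[symmetric] power_add[symmetric])
    have "4 * d * (2 * (A * r) * (p * m) + B * (p * r) / 2) + 8 * N * (C * s * (p * m))
        + 16 * N * (A * r) / k * (N\<^sup>2 * (D * (p * m)))
      = p * (2 * d * B * r + (8 * d * A + 16 * N * A / k * N\<^sup>2 * D) * (r * m) + 8 * N * C * s * m)"
      for A B C D s k p r :: real
      by (simp add: distrib_left distrib_right)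
    then show ?thesis
      unfolding error_const_def unfolding R sq n d_def[symmetric] N_def[symmetric] \<alpha>_def \<beta>_def \<gamma>_def .
  qed
  then have "4 / (\<kappa>\<^sup>2 * h\<^sup>2) * (l * error_const) = 4 * l / \<kappa>\<^sup>2 * (\<beta> * h ^ 4 + \<alpha> * (h ^ 4 * m) + \<gamma> * m)"
    using h by simp
  also have "\<dots> \<le> 4 * l / \<kappa>\<^sup>2 * ((\<beta> + \<alpha> * H ^ 4 + \<gamma>) * (h ^ 4 + m))"
  proof (rule mult_left_mono)
    have "h ^ 4 * m \<le> H ^ 4 * m"
      using h pos by (intro mult_right_mono power_mono) auto
    then have "\<alpha> * (h ^ 4 * m) \<le> \<alpha> * (H ^ 4 * m)"
      by (rule mult_left_mono) (use pos in simp)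
    moreover have "0 \<le> \<beta> * m" "0 \<le> \<alpha> * H ^ 4 * h ^ 4" "0 \<le> \<gamma> * h ^ 4"
      using pos h by simp_all
    ultimately show "\<beta> * h ^ 4 + \<alpha> * (h ^ 4 * m) + \<gamma> * m \<le> (\<beta> + \<alpha> * H ^ 4 + \<gamma>) * (h ^ 4 + m)"
      by (simp add: algebra_simps)
  qed (simp add: l_def)
  finally show ?thesis
    unfolding \<alpha>_def \<beta>_def \<gamma>_def m_def d_def N_def l_def by (simp only: mult.assoc)
qed

theorem theorem1:
  fixes \<X> \<O> :: "(real ^ 'd) set"
    and \<phi> :: "(real ^ 'd) \<times> (real ^ 'l) \<Rightarrow> real"
    and lam L\<phi> lc Lc lhat :: real
    and c :: "real ^ 'd \<Rightarrow> real ^ 'l"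
    and M :: "'w measure"
    and \<epsilon> :: "'w \<Rightarrow> real ^ 'l"
    and \<xi> :: "real ^ 'd \<Rightarrow> 'w \<Rightarrow> real ^ 'l"
    and h :: "nat \<Rightarrow> real"
    and g K :: "real ^ 'd \<Rightarrow> real"
    and \<kappa> :: real
    and X U :: "nat \<Rightarrow> real ^ 'd \<Rightarrow> nat \<Rightarrow> 'w \<Rightarrow> real ^ 'd"
    and e Y :: "nat \<Rightarrow> real ^ 'd \<Rightarrow> nat \<Rightarrow> 'w \<Rightarrow> real ^ 'l"
    and cbar :: "nat \<Rightarrow> real ^ 'd \<Rightarrow> 'w \<Rightarrow> real ^ 'l"
    and G :: "nat \<Rightarrow> real ^ 'd \<Rightarrow> 'w \<Rightarrow> real ^ 'd ^ 'l"
  assumes A1: "\<X> \<noteq> {}" "closed \<X>" "convex \<X>" "\<X> \<subseteq> \<O>" "open \<O>" "convex \<O>"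
    and A2: "0 \<le> lam" "weakly_convex_on lam (\<O> \<times> UNIV) \<phi>"
      "lipschitz_on L\<phi> (\<O> \<times> UNIV) \<phi>"
    and prob: "prob_space M"
    and A3: "\<And>x \<omega>. x \<in> \<O> \<Longrightarrow> \<omega> \<in> space M \<Longrightarrow> \<xi> x \<omega> = c x + \<epsilon> \<omega>"
      "\<epsilon> \<in> borel_measurable M"
      "integrable M (\<lambda>\<omega>. (norm (\<epsilon> \<omega>))\<^sup>2)"
      "integral\<^sup>L M \<epsilon> = 0"
    and A4: "lipschitz_on lc \<O> c" "Ck_on 1 \<O> c"
      "\<And>x y. x \<in> \<O> \<Longrightarrow> y \<in> \<O> \<Longrightarrow>
         op_norm (jacobian c (at x) - jacobian c (at y)) \<le> Lc * norm (x - y)"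
    and h: "\<And>n. 1 \<le> n \<Longrightarrow> 0 < h n" "antimono_on {1..} h" "h \<longlonglongrightarrow> 0"
    and g_density: "\<And>u. 0 \<le> g u" "g \<in> borel_measurable borel"
      "(\<integral>\<^sup>+ u. ennreal (g u) \<partial>lborel) = 1"
    and g_even: "\<And>u. g (- u) = g u"
    and g_supp: "compact (supp g)"
    and X_plus: "{z + t *\<^sub>R u | z t u. z \<in> \<X> \<and> u \<in> supp g \<and> t \<in> {0..(SUP n\<in>{1..}. h n)}} \<subseteq> \<O>"
    and c_smooth: "Ck_on 3 \<O> c" "deriv_bounded_on 2 \<O> c" "deriv_bounded_on 3 \<O> c"
    and K: "\<And>u. 0 \<le> K u" "\<And>u. u \<in> supp g \<Longrightarrow> K (- u) = K u" "bounded (K ` supp g)"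
    and K_moment: "0 < \<kappa>"
      "loewner_ge (LINT u:supp g|lborel. (K u * g u) *\<^sub>R outer (\<psi> u)) (\<kappa> *\<^sub>R mat 1)"
    and design: "\<And>n z i \<omega>. 1 \<le> n \<Longrightarrow> z \<in> \<X> \<Longrightarrow> i \<in> {1..n} \<Longrightarrow> \<omega> \<in> space M \<Longrightarrow>
         X n z i \<omega> = z + h n *\<^sub>R U n z i \<omega>"
      "\<And>n z. 1 \<le> n \<Longrightarrow> z \<in> \<X> \<Longrightarrow>
         prob_space.indep_vars M (\<lambda>_. borel) (X n z) {1..n}"
      "\<And>n z i. 1 \<le> n \<Longrightarrow> z \<in> \<X> \<Longrightarrow> i \<in> {1..n} \<Longrightarrow>
         distributed M lborel (X n z i)
           (\<lambda>x. ennreal (g ((x - z) /\<^sub>R h n) / h n ^ CARD('d)))"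
    and noise: "\<And>n z. 1 \<le> n \<Longrightarrow> z \<in> \<X> \<Longrightarrow>
         prob_space.indep_vars M (\<lambda>_. borel) (e n z) {1..n}"
      "\<And>n z i. 1 \<le> n \<Longrightarrow> z \<in> \<X> \<Longrightarrow> i \<in> {1..n} \<Longrightarrow>
         distr M borel (e n z i) = distr M borel \<epsilon>"
      "\<And>n z. 1 \<le> n \<Longrightarrow> z \<in> \<X> \<Longrightarrow>
         indep_rv M
           (\<Pi>\<^sub>M i\<in>{1..n}. borel) (\<lambda>\<omega>. \<lambda>i\<in>{1..n}. e n z i \<omega>)
           (\<Pi>\<^sub>M i\<in>{1..n}. borel) (\<lambda>\<omega>. \<lambda>i\<in>{1..n}. U n z i \<omega>)"
    and response: "\<And>n z i \<omega>. 1 \<le> n \<Longrightarrow> z \<in> \<X> \<Longrightarrow> i \<in> {1..n} \<Longrightarrow> \<omega> \<in> space M \<Longrightarrow>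
         Y n z i \<omega> = c (X n z i \<omega>) + e n z i \<omega>"
    and estimator: "\<And>n z. 1 \<le> n \<Longrightarrow> z \<in> \<X> \<Longrightarrow>
         (\<lambda>\<omega>. (cbar n z \<omega>, G n z \<omega>)) \<in> borel_measurable M"
      "\<And>n z \<omega>. 1 \<le> n \<Longrightarrow> z \<in> \<X> \<Longrightarrow> \<omega> \<in> space M \<Longrightarrow>
         is_arg_min (local_linear_loss K (h n) n (\<lambda>i. U n z i \<omega>) (\<lambda>i. Y n z i \<omega>))
           (\<lambda>_. True) (cbar n z \<omega>, G n z \<omega>)"
    and lhat: "lc \<le> lhat"
  shows "\<exists>C0 C1 c0 :: real. 0 < C0 \<and> 0 < C1 \<and> 0 < c0 \<and>
    (\<forall>n\<ge>1. (SUP z\<in>\<X>. \<integral>\<^sup>+ \<omega>.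
          ennreal ((op_norm (truncate lhat (G n z \<omega>) - jacobian c (at z)))\<^sup>2) \<partial>M)
        \<le> ennreal (C0 * ((h n) ^ 4 + 1 / (real n * (h n)\<^sup>2)) + C1 * exp (- c0 * real n)))"
proof -
  interpret prob_space M by (rule prob)
  have c_diff: "c differentiable (at x)" if "x \<in> \<O>" for x
    using iter_deriv_differentiable[OF c_smooth(1), of "[]"] that by (simp add: iter_deriv_Nil)
  obtain B2 where B2: "0 \<le> B2" "\<And>x vs. x \<in> \<O> \<Longrightarrow> length vs = 2 \<Longrightarrow>
      norm (iter_deriv c vs x) \<le> B2 * prod_list (map norm vs)"
    by (rule deriv_bounded_onE[OF c_smooth(2)]) blast
  obtain B3 where B3: "0 \<le> B3" "\<And>x vs. x \<in> \<O> \<Longrightarrow> length vs = 3 \<Longrightarrow>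
      norm (iter_deriv c vs x) \<le> B3 * prod_list (map norm vs)"
    by (rule deriv_bounded_onE[OF c_smooth(3)]) blast
  obtain \<rho>0 where \<rho>0: "\<And>u. u \<in> supp g \<Longrightarrow> norm u \<le> \<rho>0"
    using compact_imp_bounded[OF g_supp] unfolding bounded_iff by blast
  \<comment> \<open>The maximum with 1 covers the constant coordinate of \<psi>; the one in
    \<open>W\<close> below ensures positivity.\<close>
  define \<rho> where "\<rho> = max 1 \<rho>0"
  have \<rho>: "1 \<le> \<rho>" "\<And>u. u \<in> supp g \<Longrightarrow> norm u \<le> \<rho>"
    using \<rho>0 by (auto simp: \<rho>_def intro: max.coboundedI2)
  obtain W0 where W0: "\<And>u. u \<in> supp g \<Longrightarrow> \<bar>K u\<bar> \<le> W0"
    using K(3) unfolding bounded_iff by auto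
  define W where "W = max 1 W0"
  have W: "0 < W" "\<And>u. u \<in> supp g \<Longrightarrow> \<bar>K u\<bar> \<le> W"
    using W0 by (auto simp: W_def intro: max.coboundedI2)
  \<comment> \<open>Setting the kernel to zero where the density vanishes makes it bounded, even and
    boundedly supported on the whole space.\<close>
  define w where "w u = (if g u = 0 then 0 else K u)" for u
  define P where "P = density lborel (\<lambda>u. ennreal (g u))"
  note wm = weight_moments[OF g_density(1,2) K_moment, folded w_def P_def]
  have supp_minus: "- u \<in> supp g" if "u \<in> supp g" for u
    by (rule supp_uminus[OF g_even that])
  have w_even: "w (- u) = w u" for u
    using K(2)[OF nonzero_in_supp[of g u]] by (auto simp: w_def g_even)
  have w_le: "\<bar>w u\<bar> \<le> W" for u
    using W(1) W(2)[OF nonzero_in_supp[of g u]] by (simp add: w_def)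
  have w_supp: "norm u \<le> \<rho>" if "w u \<noteq> 0" for u
    using that \<rho>(2)[OF nonzero_in_supp[of g u]] by (auto simp: w_def split: if_splits)
  \<comment> \<open>Boundedness makes the supremum in \<open>X_plus\<close> a genuine upper bound of
    every bandwidth.\<close>
  have bdd: "bdd_above (h ` {1..})"
    by (rule bdd_aboveI2[of _ _ "h 1"]) (use h(2) in \<open>auto simp: monotone_on_def\<close>)
  define H where "H = h 1"
  have h_le: "h n \<le> H" if "1 \<le> n" for n
    using h(2) that by (auto simp: monotone_on_def H_def)
  have in_\<O>: "z + h n *\<^sub>R u \<in> \<O>" if "z \<in> \<X>" "u \<in> supp g" "1 \<le> n" for z u n
  proof -
    have "h n \<in> {0..(SUP n\<in>{1..}. h n)}"
      using h(1)[OF that(3)] cSUP_upper[OF _ bdd, of n] that(3) by simp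
    then show ?thesis using X_plus that by blast
  qed
  define a where "a = B2 * \<rho>\<^sup>2 / 2"
  define b where "b = B3 * \<rho> ^ 3 / 3"
  define \<tau> where "\<tau> = expectation (\<lambda>\<omega>. (norm (\<epsilon> \<omega>))\<^sup>2)"
  define N where "N = real CARD('d option)"
  define C where "C = 4 * real CARD('l) / \<kappa>\<^sup>2 * (2 * real CARD('d) * (W * \<rho> * b)\<^sup>2
        + (8 * real CARD('d) * (W * \<rho> * a)\<^sup>2
          + 16 * N * (W * \<rho> * a)\<^sup>2 / \<kappa>\<^sup>2 * N\<^sup>2 * (W * \<rho> * \<rho>)\<^sup>2) * H ^ 4
        + 8 * N * (W * \<rho>)\<^sup>2 * \<tau>)"
  \<comment> \<open>The Hoeffding rate at threshold \<eta> for the moment functions, which are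
    bounded by \<open>W * \<rho> * \<rho>\<close>; neither \<open>n\<close> nor \<open>z\<close>
    enters.\<close>
  define c0 where "c0 = (\<kappa> / (2 * N))\<^sup>2 / (2 * (W * \<rho> * \<rho>)\<^sup>2)"
  have main: "(\<integral>\<^sup>+ \<omega>. ennreal ((op_norm (truncate lhat (G n z \<omega>) - jacobian c (at z)))\<^sup>2) \<partial>M)
    \<le> ennreal (C * (h n ^ 4 + 1 / (real n * (h n)\<^sup>2)) + (2 * lhat)\<^sup>2 * (N\<^sup>2 * 2) * exp (- c0 * real n))"
    if n: "1 \<le> n" and z: "z \<in> \<X>" for n z
  proof -
    define J where "J = jacobian c (at z)"
    have z\<O>: "z \<in> \<O>" using z A1(4) by blast
    have J: "J *v v = frechet_derivative c (at z) v" for v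
      using frechet_derivative_at[of c "\<lambda>v. J *v v" z] jacobian_works[of c "at z"] c_diff[OF z\<O>]
      by (simp add: J_def)
    have hn: "0 < h n" by (rule h(1)[OF n])
    \<comment> \<open>A version of the standardized design defined everywhere from \<open>X\<close>,
      from which it inherits independence and law; it agrees with \<open>U\<close> on
      \<open>space M\<close>.\<close>
    define U' where "U' i \<omega> = (X n z i \<omega> - z) /\<^sub>R h n" for i \<omega>
    have U': "U n z i \<omega> = U' i \<omega>" if "i \<in> {1..n}" "\<omega> \<in> space M" for i \<omega>
      using design(1)[OF n z that] hn by (simp add: U'_def)
    \<comment> \<open>Outside the support \<open>z + h n *\<^sub>R u\<close> may leave \<O>, where
      nothing is known about \<open>c\<close>; the value 0 keeps the bounds global.\<close>
    define r where "r u = (if u \<in> supp g then c (z + h n *\<^sub>R u) - c z - h n *\<^sub>R (J *v u) else 0)" for u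
    have r_le: "norm (r u) \<le> a * (h n)\<^sup>2" for u
    proof (cases "u \<in> supp g")
      case True
      have "norm (c (z + h n *\<^sub>R u) - c z - frechet_derivative c (at z) (h n *\<^sub>R u))
          \<le> B2 * (norm (h n *\<^sub>R u))\<^sup>2 / 2"
        by (rule first_order_remainder[OF A1(6) z\<O> in_\<O>[OF z True n] c_smooth(1) _ B2(2)]) auto
      also have "\<dots> \<le> B2 * (h n * \<rho>)\<^sup>2 / 2"
        using hn B2(1) \<rho>(2)[OF True] by (intro divide_right_mono mult_left_mono power_mono) auto
      also have "frechet_derivative c (at z) (h n *\<^sub>R u) = h n *\<^sub>R (J *v u)"
        unfolding J[symmetric] by (rule matrix_vector_mult_scaleR)
      finally show ?thesis
        using True by (simp add: r_def a_def power_mult_distrib mult_ac)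
    qed (use B2(1) in \<open>simp add: r_def a_def\<close>)
    have r_odd: "norm (r u - r (- u)) \<le> b * h n ^ 3" for u
    proof (cases "u \<in> supp g")
      case True
      have minus: "- u \<in> supp g" by (rule supp_minus[OF True])
      have "norm (c (z + h n *\<^sub>R u) - c (z - h n *\<^sub>R u) - 2 *\<^sub>R frechet_derivative c (at z) (h n *\<^sub>R u))
          \<le> B3 * norm (h n *\<^sub>R u) ^ 3 / 3"
        by (rule central_difference_remainder[OF A1(6) z\<O> in_\<O>[OF z True n] _ c_smooth(1) _ B3(2)])
           (use in_\<O>[OF z minus n] in auto)
      also have "\<dots> \<le> B3 * (h n * \<rho>) ^ 3 / 3"
        using hn B3(1) \<rho>(2)[OF True] by (intro divide_right_mono mult_left_mono power_mono) auto
      also have "c (z + h n *\<^sub>R u) - c (z - h n *\<^sub>R u) - 2 *\<^sub>R frechet_derivative c (at z) (h n *\<^sub>R u) = r u - r (- u)"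
        using True minus
        by (simp add: r_def J[symmetric] matrix_vector_mult_scaleR linear_neg[OF matrix_vector_mul_linear]
            scaleR_2 del: scaleR_scaleR)
      finally show ?thesis
        by (simp add: b_def power_mult_distrib mult_ac)
    next
      case False
      then have "- u \<notin> supp g" using supp_minus[of "- u"] by auto
      with False show ?thesis using B3(1) \<rho>(1) hn by (simp add: r_def b_def)
    qed
    have r_meas: "r \<in> borel_measurable borel"
      unfolding r_def[abs_def]
    proof (rule borel_measurable_continuous_on_if)
      show "supp g \<in> sets borel" by (simp add: supp_def)
      have "continuous_on \<O> c"
        using c_diff by (intro continuous_at_imp_continuous_on ballI differentiable_imp_continuous_within)
      then have "continuous_on (supp g) (\<lambda>u. c (z + h n *\<^sub>R u))"
        by (rule continuous_on_compose2) (auto intro!: continuous_intros in_\<O>[OF z _ n])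
      then show "continuous_on (supp g) (\<lambda>u. c (z + h n *\<^sub>R u) - c z - h n *\<^sub>R (J *v u))"
        by (intro continuous_intros linear_continuous_on[OF matrix_vector_mul_bounded_linear])
    qed simp
    have U'_distr: "distr M borel (U' i) = P" if "i \<in> {1..n}" for i
      unfolding P_def U'_def[abs_def]
      using design(3)[OF n z that] by (intro distr_standardized_design hn g_density) simp
    have joint: "indep_rv M (\<Pi>\<^sub>M i\<in>{1..n}. borel) (\<lambda>\<omega>. \<lambda>i\<in>{1..n}. e n z i \<omega>)
           (\<Pi>\<^sub>M i\<in>{1..n}. borel) (\<lambda>\<omega>. \<lambda>i\<in>{1..n}. U' i \<omega>)"
      using noise(3)[OF n z] by (rule indep_rv_cong[THEN iffD1, rotated]) (auto simp: U' intro!: restrict_ext)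
    interpret local_regression M n P U' "e n z" \<epsilon> w r W \<rho> "a * (h n)\<^sup>2" "b * h n ^ 3" \<kappa>
    proof unfold_locales
      show "indep_vars (\<lambda>_. borel) U' {1..n}"
        unfolding U'_def[abs_def] by (rule indep_vars_compose2[OF design(2)[OF n z]]) simp
      show "distr P borel uminus = P"
        unfolding P_def by (rule distr_uminus_even_density[OF g_density(2) g_even])
    qed (use n U'_distr noise(1,2)[OF n z] joint A3 wm r_meas w_even w_le w_supp W(1) \<rho>(1) K_moment(1)
        r_le r_odd in auto)
    have "onorm ((*v) J) \<le> lc"
    proof (rule onorm_le)
      show "norm (J *v v) \<le> lc * norm v" for v
        unfolding J by (rule frechet_derivative_norm_le_lipschitz[OF A4(1) A1(5) z\<O> c_diff[OF z\<O>]])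
    qed
    then have J_le: "op_norm J \<le> lhat"
      using lhat by (simp add: op_norm_def)
    \<comment> \<open>Almost surely every design point falls where the density is positive. There
      \<open>w\<close> is the kernel and \<open>r\<close> the true Taylor remainder, so the normal
      equations take the abstract form.\<close>
    have AE_P: "AE u in P. g u \<noteq> 0"
      unfolding P_def using g_density(1,2) by (subst AE_density) auto
    have "AE \<omega> in M. g (U' i \<omega>) \<noteq> 0" if "i \<in> {1..n}" for i
      using AE_P unfolding U'_distr[OF that, symmetric] by (rule AE_distrD[OF U_measurable[OF that]])
    then have "AE \<omega> in M. \<forall>i\<in>{1..n}. g (U' i \<omega>) \<noteq> 0"
      by (intro AE_finite_allI) auto
    then have "AE \<omega> in M. \<forall>k p. (\<Sum>q\<in>UNIV. T p q \<omega> *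
        error_row (h n) (cbar n z \<omega> - c z) (G n z \<omega> - J) k $ q) = bias k p \<omega> + noise k p \<omega>"
      using AE_space
    proof eventually_elim
      case (elim \<omega>)
      let ?u = "\<lambda>i. U n z i \<omega>"
      have wK: "w (U' i \<omega>) = K (?u i)" and res: "Y n z i \<omega> - c z - h n *\<^sub>R (J *v ?u i) = r (U' i \<omega>) + e n z i \<omega>"
        and u: "?u i = U' i \<omega>" if i: "i \<in> {1..n}" for i
      proof -
        show u: "?u i = U' i \<omega>" by (rule U'[OF i elim(2)])
        have g: "g (U' i \<omega>) \<noteq> 0" using elim(1) i by blast
        show "w (U' i \<omega>) = K (?u i)" using g by (simp add: w_def u)
        show "Y n z i \<omega> - c z - h n *\<^sub>R (J *v ?u i) = r (U' i \<omega>) + e n z i \<omega>"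
          using nonzero_in_supp[of g, OF g] design(1)[OF n z i elim(2)]
          by (simp add: response[OF n z i elim(2)] r_def u)
      qed
      show ?case
      proof (intro allI)
        fix k p
        have "(\<Sum>i=1..n. w (U' i \<omega>) * \<psi> (U' i \<omega>) $ p * (r (U' i \<omega>) + e n z i \<omega>) $ k)
          = (\<Sum>i=1..n. K (?u i) * \<psi> (?u i) $ p * (Y n z i \<omega> - c z - h n *\<^sub>R (J *v ?u i)) $ k)"
          by (intro sum.cong refl, simp only: wK res[symmetric], simp only: u)
        \<comment> \<open>The normal equations with the true value \<open>c z\<close> and Jacobian
          \<open>J\<close> as reference pair; division by \<open>n\<close> afterwards yields the
          empirical averages.\<close>
        also have "\<dots> = (\<Sum>q\<in>UNIV. (\<Sum>i=1..n. K (?u i) * \<psi> (?u i) $ p * \<psi> (?u i) $ q) *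
            error_row (h n) (cbar n z \<omega> - c z) (G n z \<omega> - J) k $ q)"
          using hn by (intro normal_equations K(1) estimator(2)[OF n z elim(2)]) simp
        also have "\<dots> = (\<Sum>q\<in>UNIV. (\<Sum>i=1..n. w (U' i \<omega>) * \<psi> (U' i \<omega>) $ p * \<psi> (U' i \<omega>) $ q) *
            error_row (h n) (cbar n z \<omega> - c z) (G n z \<omega> - J) k $ q)"
          by (intro sum.cong refl arg_cong2[where f = "(*)"]) (simp_all only: wK u)
        finally show "(\<Sum>q\<in>UNIV. T p q \<omega> * error_row (h n) (cbar n z \<omega> - c z) (G n z \<omega> - J) k $ q)
          = bias k p \<omega> + noise k p \<omega>"
          by (simp add: T_def bias_def noise_def avg_def avg_noise_def sum_divide_distrib[symmetric]
              add_divide_distrib[symmetric] sum.distrib[symmetric] distrib_left)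
      qed
    qed
    from truncated_slope_mse[OF hn J_le this]
    have "(\<integral>\<^sup>+ \<omega>. ennreal ((op_norm (truncate lhat (G n z \<omega>) - J))\<^sup>2) \<partial>M)
      \<le> ennreal (4 / (\<kappa>\<^sup>2 * (h n)\<^sup>2) * (CARD('l) * error_const)
        + (2 * lhat)\<^sup>2 * (N\<^sup>2 * (2 * exp (- real n * \<eta>\<^sup>2 / (2 * (W * \<rho> * \<rho>)\<^sup>2)))))"
      by (simp only: N_def)
    also have "\<dots> \<le> ennreal (C * (h n ^ 4 + 1 / (real n * (h n)\<^sup>2)) + (2 * lhat)\<^sup>2 * (N\<^sup>2 * 2) * exp (- c0 * real n))"
    proof (intro ennreal_leI add_mono)
      show "4 / (\<kappa>\<^sup>2 * (h n)\<^sup>2) * (CARD('l) * error_const) \<le> C * (h n ^ 4 + 1 / (real n * (h n)\<^sup>2))"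
        using scaled_error_const_le[OF hn h_le[OF n] refl refl]
        unfolding C_def N_def \<tau>_def \<sigma>2_def .
      have "- real n * \<eta>\<^sup>2 / (2 * (W * \<rho> * \<rho>)\<^sup>2) = - c0 * real n"
        by (simp only: c0_def \<eta>_def N_def) simp
      then show "(2 * lhat)\<^sup>2 * (N\<^sup>2 * (2 * exp (- real n * \<eta>\<^sup>2 / (2 * (W * \<rho> * \<rho>)\<^sup>2))))
          \<le> (2 * lhat)\<^sup>2 * (N\<^sup>2 * 2) * exp (- c0 * real n)"
        by simp
    qed
    finally show ?thesis unfolding J_def .
  qed
  have C: "0 \<le> C"
    unfolding C_def N_def \<tau>_def
    by (intro mult_nonneg_nonneg add_nonneg_nonneg divide_nonneg_nonneg) auto
  have c0: "0 < c0"
    using K_moment(1) W(1) \<rho>(1) by (auto simp: c0_def N_def intro!: divide_pos_pos mult_pos_pos)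
  \<comment> \<open>Adding 1 here and to \<open>C\<close> makes both constants strictly positive
    even when the estimates above are degenerate.\<close>
  define C1 where "C1 = (2 * lhat)\<^sup>2 * (N\<^sup>2 * 2) + 1"
  have "(SUP z\<in>\<X>. \<integral>\<^sup>+ \<omega>. ennreal ((op_norm (truncate lhat (G n z \<omega>) - jacobian c (at z)))\<^sup>2) \<partial>M)
      \<le> ennreal ((C + 1) * (h n ^ 4 + 1 / (real n * (h n)\<^sup>2)) + C1 * exp (- c0 * real n))"
    if n: "1 \<le> n" for n
  proof (rule SUP_least)
    fix z assume "z \<in> \<X>"
    note main[OF n this]
    also have "ennreal (C * (h n ^ 4 + 1 / (real n * (h n)\<^sup>2)) + (2 * lhat)\<^sup>2 * (N\<^sup>2 * 2) * exp (- c0 * real n))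
      \<le> ennreal ((C + 1) * (h n ^ 4 + 1 / (real n * (h n)\<^sup>2)) + C1 * exp (- c0 * real n))"
      by (intro ennreal_leI add_mono mult_right_mono) (auto simp: C1_def)
    finally show "(\<integral>\<^sup>+ \<omega>. ennreal ((op_norm (truncate lhat (G n z \<omega>) - jacobian c (at z)))\<^sup>2) \<partial>M)
      \<le> ennreal ((C + 1) * (h n ^ 4 + 1 / (real n * (h n)\<^sup>2)) + C1 * exp (- c0 * real n))" .
  qed
  moreover have "0 < C1" by (simp add: C1_def add_nonneg_pos)
  ultimately show ?thesis
    using C c0 by (intro exI[of _ "C + 1"] exI[of _ C1] exI[of _ c0]) auto
qed

end
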